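(* Let $G$ be a group with finite generating set $A$, let $r \geq 1$, and let $S$ be the standard generating set (standard basis) of $\mathbb{Z}^r$. Then $$\mathrm{PW}(G \wr \mathbb{Z}^r, A \cup S) \ \leq \ 3r + \mathrm{PW}(G,A).$$ Moreover, when $r=1$, $$\mathrm{PW}(G \wr \mathbb{Z}, A \cup \{t\}) \ \leq \ 2 + \mathrm{PW}(G,A),$$ where $t$ is a generator of $\mathbb{Z}$.
   Context: For a group $H$ with generating set $X$, a palindromic word (palindrome) on $X \cup X^{-1}$ is a finite word with letters in $X\cup X^{-1}$ (not necessarily reduced) that reads the same forwards as backwards. The palindromic width $\mathrm{PW}(H,X)$ is the minimal $n$ such that every $h\in H$ can be expressed as a product of $n$ or fewer elements represented by palindromic words on $X\cup X^{-1}$; if no such $n$ exists, $\mathrm{PW}(H,X)=\infty$ (so the inequalities are vacuous when $\mathrm{PW}(G,A)=\infty$). $G \wr \mathbb{Z}^r = \left(\bigoplus_{\mathbb{Z}^r} G\right) \rtimes \mathbb{Z}^r$, where $\bigoplus_{\mathbb{Z}^r} G$ is the group of finitely supported functions $\mathbb{Z}^r \to G$ under pointwise multiplication, and $\mathbf{v} \in \mathbb{Z}^r$ acts by the shift $f^{\mathbf{v}}(\mathbf{x}) = f(\mathbf{x}-\mathbf{v})$. The group $G$ is viewed as the subgroup of functions supported at $\mathbf{0}$ (paired with $\mathbf{0} \in \mathbb{Z}^r$), and $\mathbb{Z}^r$ as the subgroup of pairs whose first entry is the trivial function. *)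

theory Defs
  imports "HOL-Algebra.Product_Groups" "HOL-Library.Extended_Nat"
begin

definition group_prod :: "('a, 'b) monoid_scheme \<Rightarrow> 'a list \<Rightarrow> 'a" where
  "group_prod G w = foldr (\<otimes>\<^bsub>G\<^esub>) w \<one>\<^bsub>G\<^esub>"

text \<open>
  A word on \<open>X \<union> X\<^sup>-\<^sup>1\<close> is a list of group elements rather than of formal letters. Formal letters that
  denote the same element are thereby identified; this does not change the set of elements
  represented by palindromes, since one formal letter can be chosen for every element.
\<close>
definition palindromes :: "('a, 'b) monoid_scheme \<Rightarrow> 'a set \<Rightarrow> 'a list set" where
  "palindromes G X = {w \<in> lists (X \<union> m_inv G ` X). rev w = w}"

text \<open>The infimum in \<^typ>\<open>enat\<close> of the empty set is \<open>\<infinity>\<close>.\<close>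
definition palindromic_width :: "('a, 'b) monoid_scheme \<Rightarrow> 'a set \<Rightarrow> enat" where
  "palindromic_width G X = Inf {enat n | n.
     \<forall>g \<in> carrier G. \<exists>ps. length ps \<le> n \<and> set ps \<subseteq> group_prod G ` palindromes G X \<and>
       g = group_prod G ps}"

text \<open>
  The action of \<open>v\<close> on functions \<open>f\<close> from \<open>H\<close> to \<open>G\<close>. For abelian \<open>H\<close>, written additively,
  this is \<open>f\<^sup>v(x) = f(x - v)\<close>.
\<close>
definition shift :: "('h, 'c) monoid_scheme \<Rightarrow> 'h \<Rightarrow> ('h \<Rightarrow> 'a) \<Rightarrow> 'h \<Rightarrow> 'a" where
  "shift H v f = (\<lambda>x \<in> carrier H. f (inv\<^bsub>H\<^esub> v \<otimes>\<^bsub>H\<^esub> x))"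

text \<open>
  The restricted wreath product. Elements of \<^const>\<open>sum_group\<close> are the finitely supported
  functions from \<open>carrier H\<close> to \<open>carrier G\<close>, \<^const>\<open>undefined\<close> outside \<open>carrier H\<close>.
\<close>
definition wreath ::
  "('a, 'b) monoid_scheme \<Rightarrow> ('h, 'c) monoid_scheme \<Rightarrow> (('h \<Rightarrow> 'a) \<times> 'h) monoid" where
  "wreath G H =
     (let B = sum_group (carrier H) (\<lambda>_. G) in
      \<lparr>carrier = carrier B \<times> carrier H,
       mult = (\<lambda>(f, v) (g, w). (f \<otimes>\<^bsub>B\<^esub> shift H v g, v \<otimes>\<^bsub>H\<^esub> w)),
       one = (\<one>\<^bsub>B\<^esub>, \<one>\<^bsub>H\<^esub>)\<rparr>)"

definition wreath_base ::
  "('a, 'b) monoid_scheme \<Rightarrow> ('h, 'c) monoid_scheme \<Rightarrow> 'a \<Rightarrow> ('h \<Rightarrow> 'a) \<times> 'h" where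
  "wreath_base G H a =
     ((\<lambda>x \<in> carrier H. if x = \<one>\<^bsub>H\<^esub> then a else \<one>\<^bsub>G\<^esub>), \<one>\<^bsub>H\<^esub>)"

definition wreath_top ::
  "('a, 'b) monoid_scheme \<Rightarrow> ('h, 'c) monoid_scheme \<Rightarrow> 'h \<Rightarrow> ('h \<Rightarrow> 'a) \<times> 'h" where
  "wreath_top G H v = ((\<lambda>x \<in> carrier H. \<one>\<^bsub>G\<^esub>), v)"

abbreviation int_lattice :: "nat \<Rightarrow> (nat \<Rightarrow> int) monoid" where
  "int_lattice r \<equiv> product_group {..<r} (\<lambda>_. integer_group)"

definition standard_basis :: "nat \<Rightarrow> (nat \<Rightarrow> int) set" where
  "standard_basis r = (\<lambda>i. \<lambda>j \<in> {..<r}. if j = i then 1 else 0) ` {..<r}"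

lemma shift_int_lattice:
  assumes "v \<in> carrier (int_lattice r)" "x \<in> carrier (int_lattice r)"
  shows "shift (int_lattice r) v f x = f (\<lambda>i \<in> {..<r}. x i - v i)"
proof -
  have "inv\<^bsub>int_lattice r\<^esub> v = (\<lambda>i \<in> {..<r}. - v i)"
    using assms(1) by (subst inv_product_group) auto
  then have "inv\<^bsub>int_lattice r\<^esub> v \<otimes>\<^bsub>int_lattice r\<^esub> x = (\<lambda>i \<in> {..<r}. x i - v i)"
    by (auto simp: restrict_def)
  with assms show ?thesis by (simp add: shift_def)
qed

lemma carrier_wreath:
  assumes "group G"
  shows "carrier (wreath G H) =
    {f \<in> carrier H \<rightarrow>\<^sub>E carrier G. finite {x \<in> carrier H. f x \<noteq> \<one>\<^bsub>G\<^esub>}} \<times> carrier H"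
  using assms by (simp add: wreath_def Let_def carrier_sum_group)

lemma mult_wreath:
  "(f, v) \<otimes>\<^bsub>wreath G H\<^esub> (g, w) =
    ((\<lambda>x \<in> carrier H. f x \<otimes>\<^bsub>G\<^esub> shift H v g x), v \<otimes>\<^bsub>H\<^esub> w)"
  by (simp add: wreath_def Let_def sum_group_def)

lemma one_wreath: "\<one>\<^bsub>wreath G H\<^esub> = ((\<lambda>x \<in> carrier H. \<one>\<^bsub>G\<^esub>), \<one>\<^bsub>H\<^esub>)"
  by (simp add: wreath_def Let_def sum_group_def)

lemma shift_closed:
  assumes "group G" "group H" "v \<in> carrier H"
    and f: "f \<in> carrier H \<rightarrow>\<^sub>E carrier G" "finite {x \<in> carrier H. f x \<noteq> \<one>\<^bsub>G\<^esub>}"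
  shows "shift H v f \<in> carrier H \<rightarrow>\<^sub>E carrier G"
    and "finite {x \<in> carrier H. shift H v f x \<noteq> \<one>\<^bsub>G\<^esub>}"
proof -
  interpret H: group H by fact
  show "shift H v f \<in> carrier H \<rightarrow>\<^sub>E carrier G"
    using assms by (auto simp: shift_def)
  have "{x \<in> carrier H. shift H v f x \<noteq> \<one>\<^bsub>G\<^esub>}
      \<subseteq> (\<lambda>y. v \<otimes>\<^bsub>H\<^esub> y) ` {x \<in> carrier H. f x \<noteq> \<one>\<^bsub>G\<^esub>}"
  proof
    fix x assume x: "x \<in> {x \<in> carrier H. shift H v f x \<noteq> \<one>\<^bsub>G\<^esub>}"
    then have "x = v \<otimes>\<^bsub>H\<^esub> (inv\<^bsub>H\<^esub> v \<otimes>\<^bsub>H\<^esub> x)"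
      using \<open>v \<in> carrier H\<close> by (simp add: H.m_assoc [symmetric])
    moreover have "inv\<^bsub>H\<^esub> v \<otimes>\<^bsub>H\<^esub> x \<in> {x \<in> carrier H. f x \<noteq> \<one>\<^bsub>G\<^esub>}"
      using x \<open>v \<in> carrier H\<close> by (auto simp: shift_def)
    ultimately show "x \<in> (\<lambda>y. v \<otimes>\<^bsub>H\<^esub> y) ` {x \<in> carrier H. f x \<noteq> \<one>\<^bsub>G\<^esub>}"
      by blast
  qed
  then show "finite {x \<in> carrier H. shift H v f x \<noteq> \<one>\<^bsub>G\<^esub>}"
    using f(2) finite_surj by blast
qed

lemma group_wreath:
  assumes "group G" "group H"
  shows "group (wreath G H)"
proof -
  interpret G: group G by fact
  interpret H: group H by fact
  show ?thesis
  proof (rule groupI)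
    fix p q assume "p \<in> carrier (wreath G H)" "q \<in> carrier (wreath G H)"
    then obtain f v g w where *: "p = (f, v)" "q = (g, w)" "v \<in> carrier H" "w \<in> carrier H"
      "f \<in> carrier H \<rightarrow>\<^sub>E carrier G" "finite {x \<in> carrier H. f x \<noteq> \<one>\<^bsub>G\<^esub>}"
      "g \<in> carrier H \<rightarrow>\<^sub>E carrier G" "finite {x \<in> carrier H. g x \<noteq> \<one>\<^bsub>G\<^esub>}"
      by (auto simp: carrier_wreath [OF assms(1)])
    note s = shift_closed [OF assms *(3,7,8)]
    have "{x \<in> carrier H. f x \<otimes>\<^bsub>G\<^esub> shift H v g x \<noteq> \<one>\<^bsub>G\<^esub>} \<subseteq>
      {x \<in> carrier H. f x \<noteq> \<one>\<^bsub>G\<^esub>} \<union> {x \<in> carrier H. shift H v g x \<noteq> \<one>\<^bsub>G\<^esub>}"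
      by auto
    then have "finite {x \<in> carrier H. f x \<otimes>\<^bsub>G\<^esub> shift H v g x \<noteq> \<one>\<^bsub>G\<^esub>}"
      using *(6) s(2) by (meson finite_UnI finite_subset)
    moreover have "{x \<in> carrier H. (x \<in> carrier H \<longrightarrow> f x \<otimes>\<^bsub>G\<^esub> shift H v g x \<noteq> \<one>\<^bsub>G\<^esub>)}
      = {x \<in> carrier H. f x \<otimes>\<^bsub>G\<^esub> shift H v g x \<noteq> \<one>\<^bsub>G\<^esub>}" by auto
    ultimately show "p \<otimes>\<^bsub>wreath G H\<^esub> q \<in> carrier (wreath G H)"
      using * s(1) by (auto simp: carrier_wreath [OF assms(1)] mult_wreath PiE_iff cong: conj_cong)
  next
    show "\<one>\<^bsub>wreath G H\<^esub> \<in> carrier (wreath G H)"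
      by (auto simp: carrier_wreath [OF assms(1)] one_wreath cong: conj_cong)
  next
    fix p q r assume "p \<in> carrier (wreath G H)" "q \<in> carrier (wreath G H)" "r \<in> carrier (wreath G H)"
    then obtain f v g w h u where *: "p = (f, v)" "q = (g, w)" "r = (h, u)"
      "v \<in> carrier H" "w \<in> carrier H" "u \<in> carrier H"
      "f \<in> carrier H \<rightarrow>\<^sub>E carrier G" "g \<in> carrier H \<rightarrow>\<^sub>E carrier G" "h \<in> carrier H \<rightarrow>\<^sub>E carrier G"
      by (auto simp: carrier_wreath [OF assms(1)])
    then show "p \<otimes>\<^bsub>wreath G H\<^esub> q \<otimes>\<^bsub>wreath G H\<^esub> r = p \<otimes>\<^bsub>wreath G H\<^esub> (q \<otimes>\<^bsub>wreath G H\<^esub> r)"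
      by (auto simp: mult_wreath shift_def H.m_assoc H.inv_mult_group PiE_iff intro!: restrict_ext G.m_assoc)
  next
    fix p assume "p \<in> carrier (wreath G H)"
    then obtain f v where *: "p = (f, v)" "v \<in> carrier H" "f \<in> carrier H \<rightarrow>\<^sub>E carrier G"
      by (auto simp: carrier_wreath [OF assms(1)])
    have "(\<lambda>x\<in>carrier H. f x) = f" using *(3) by (simp add: PiE_restrict)
    moreover have "(\<lambda>x\<in>carrier H. \<one>\<^bsub>G\<^esub> \<otimes>\<^bsub>G\<^esub> shift H \<one>\<^bsub>H\<^esub> f x) = (\<lambda>x\<in>carrier H. f x)"
      using *(3) by (auto simp: shift_def PiE_iff intro!: restrict_ext)
    ultimately show "\<one>\<^bsub>wreath G H\<^esub> \<otimes>\<^bsub>wreath G H\<^esub> p = p"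
      using * by (simp add: mult_wreath one_wreath cong: restrict_cong)
  next
    fix p assume "p \<in> carrier (wreath G H)"
    then obtain f v where *: "p = (f, v)" "v \<in> carrier H"
      "f \<in> carrier H \<rightarrow>\<^sub>E carrier G" "finite {x \<in> carrier H. f x \<noteq> \<one>\<^bsub>G\<^esub>}"
      by (auto simp: carrier_wreath [OF assms(1)])
    define f' where "f' = (\<lambda>x \<in> carrier H. inv\<^bsub>G\<^esub> (f x))"
    have "f' \<in> carrier H \<rightarrow>\<^sub>E carrier G" using *(3) by (auto simp: f'_def PiE_iff)
    moreover have "{x \<in> carrier H. f' x \<noteq> \<one>\<^bsub>G\<^esub>} \<subseteq> {x \<in> carrier H. f x \<noteq> \<one>\<^bsub>G\<^esub>}"
      by (auto simp: f'_def)
    then have "finite {x \<in> carrier H. f' x \<noteq> \<one>\<^bsub>G\<^esub>}" using *(4) finite_subset by blast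
    ultimately have s: "shift H (inv\<^bsub>H\<^esub> v) f' \<in> carrier H \<rightarrow>\<^sub>E carrier G"
      "finite {x \<in> carrier H. shift H (inv\<^bsub>H\<^esub> v) f' x \<noteq> \<one>\<^bsub>G\<^esub>}"
      using shift_closed [OF assms, of "inv\<^bsub>H\<^esub> v" f'] *(2) by auto
    let ?q = "(shift H (inv\<^bsub>H\<^esub> v) f', inv\<^bsub>H\<^esub> v)"
    have "?q \<in> carrier (wreath G H)"
      using s *(2) by (simp add: carrier_wreath [OF assms(1)])
    moreover have "?q \<otimes>\<^bsub>wreath G H\<^esub> p = \<one>\<^bsub>wreath G H\<^esub>"
      using * by (auto simp: mult_wreath one_wreath shift_def f'_def PiE_iff intro!: restrict_ext)
    ultimately show "\<exists>q \<in> carrier (wreath G H). q \<otimes>\<^bsub>wreath G H\<^esub> p = \<one>\<^bsub>wreath G H\<^esub>" by blast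
  qed
qed

end

theory Submission
  imports Defs
begin

text \<open>
  Let \<open>S\<close> generate the abelian group \<open>H\<close>, written additively here. A word in the generators of the
  wreath product is a walk through \<open>H\<close> that leaves elements of \<open>G\<close> behind, and it is a palindrome
  only if the walk is symmetric under a reflection \<open>y \<mapsto> c - y\<close>, with values at mirror points represented
  by mutually reversed words. Conversely, for \<open>c = 0\<close> and \<open>c = s \<in> S\<close> the values on one half of \<open>H\<close>
  can be prescribed. Multiplying a function by a function symmetric about \<open>c\<close> therefore moves its
  value at \<open>y\<close> to \<open>c - y\<close>. The reflections with \<open>c \<in> S \<union> {0}\<close> act transitively on \<open>H\<close>, so one
  factor for each \<open>c\<close> suffices to move all values of a finitely supported function to \<open>0\<close>. The
  remaining value at \<open>0\<close> is a product of \<open>n = PW(G, A)\<close> palindromes, the first of which is absorbed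
  by the factor for \<open>c = 0\<close> (if \<open>n = 0\<close> then \<open>G\<close> is trivial and there is nothing to move). Finally
  an element of \<open>H\<close> is a product of \<open>|S|\<close> powers of generators, which are palindromes. Altogether
  \<open>2|S| + n\<close> palindromes suffice.
\<close>

section \<open>Palindromic products in a group\<close>

lemma group_prod_Nil [simp]: "group_prod G [] = \<one>\<^bsub>G\<^esub>"
  by (simp add: group_prod_def)

lemma group_prod_Cons [simp]: "group_prod G (x # w) = x \<otimes>\<^bsub>G\<^esub> group_prod G w"
  by (simp add: group_prod_def)

abbreviation palindromic :: "('a, 'b) monoid_scheme \<Rightarrow> 'a set \<Rightarrow> 'a set" where
  "palindromic G X \<equiv> group_prod G ` palindromes G X"

text \<open>A relation rather than a function: the value of the reversed word may depend on the
  chosen word and not only on the element that it represents.\<close>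

definition reversal_pairs :: "('a, 'b) monoid_scheme \<Rightarrow> 'a set \<Rightarrow> ('a \<times> 'a) set" where
  "reversal_pairs G X = (\<lambda>w. (group_prod G w, group_prod G (rev w))) ` lists (X \<union> m_inv G ` X)"

definition palindrome_products :: "('a, 'b) monoid_scheme \<Rightarrow> 'a set \<Rightarrow> nat \<Rightarrow> 'a set" where
  "palindrome_products G X n = {group_prod G ps | ps. length ps \<le> n \<and> set ps \<subseteq> palindromic G X}"

section \<open>Finite palindromic width as a covering by products\<close>

lemma palindrome_products_mono:
  "m \<le> n \<Longrightarrow> palindrome_products G X m \<subseteq> palindrome_products G X n"
  by (fastforce simp: palindrome_products_def)

text \<open>The products of at most \<open>n\<close> palindromes grow with \<open>n\<close>, and the
  infimum of a nonempty set in \<open>enat\<close> is attained. All later counting can therefore be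
  done with a fixed natural number.\<close>

lemma palindromic_width_le_iff:
  "palindromic_width G X \<le> enat n \<longleftrightarrow> carrier G \<subseteq> palindrome_products G X n"
proof -
  define N where "N = {n. carrier G \<subseteq> palindrome_products G X n}"
  have eq: "palindromic_width G X = Inf (enat ` N)"
  proof -
    have "palindrome_products G X n = {g. \<exists>ps. length ps \<le> n \<and> set ps \<subseteq> palindromic G X \<and>
        g = group_prod G ps}" for n
      unfolding palindrome_products_def by blast
    then show ?thesis
      unfolding palindromic_width_def N_def setcompr_eq_image by (simp add: subset_eq)
  qed
  show ?thesis
  proof
    assume le: "palindromic_width G X \<le> enat n"
    \<comment> \<open>The infimum of the empty set is infinite, so it cannot lie below
      \<open>enat n\<close>.\<close>
    then have "enat ` N \<noteq> {}"
      by (auto simp: eq Inf_enat_def)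
    then have "Inf (enat ` N) \<in> enat ` N"
      by (meson ex_in_conv wellorder_InfI)
    then obtain m where "m \<in> N" "Inf (enat ` N) = enat m"
      by blast
    then have "carrier G \<subseteq> palindrome_products G X m" "m \<le> n"
      using le by (auto simp only: eq N_def mem_Collect_eq enat_ord_simps)
    then show "carrier G \<subseteq> palindrome_products G X n"
      using palindrome_products_mono by (rule_tac subset_trans)
  next
    assume "carrier G \<subseteq> palindrome_products G X n"
    then show "palindromic_width G X \<le> enat n"
      by (auto simp: eq N_def intro: Inf_lower)
  qed
qed

section \<open>Words and their reversals in a group\<close>

context group
begin

lemma group_prod_closed: "set w \<subseteq> carrier G \<Longrightarrow> group_prod G w \<in> carrier G"
  by (induction w) auto

lemma group_prod_append:
  "set u \<subseteq> carrier G \<Longrightarrow> set w \<subseteq> carrier G \<Longrightarrow>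
    group_prod G (u @ w) = group_prod G u \<otimes> group_prod G w"
  by (induction u) (auto simp: m_assoc group_prod_closed)

lemma letters_carrier:
  assumes "X \<subseteq> carrier G" "w \<in> lists (X \<union> m_inv G ` X)"
  shows "set w \<subseteq> carrier G" "set (rev w) \<subseteq> carrier G"
  using assms by auto

lemma reversal_pairs_one: "(\<one>, \<one>) \<in> reversal_pairs G X"
  unfolding reversal_pairs_def by (rule image_eqI [where x = "[]"]) auto

lemma reversal_pairs_letter:
  assumes "X \<subseteq> carrier G" "x \<in> X \<union> m_inv G ` X"
  shows "(x, x) \<in> reversal_pairs G X"
  unfolding reversal_pairs_def by (rule image_eqI [where x = "[x]"]) (use assms in auto)

lemma reversal_pairs_mult:
  assumes X: "X \<subseteq> carrier G"
    and ab: "(a, a') \<in> reversal_pairs G X" "(b, b') \<in> reversal_pairs G X"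
  shows "(a \<otimes> b, b' \<otimes> a') \<in> reversal_pairs G X"
proof -
  obtain u w where uw: "u \<in> lists (X \<union> m_inv G ` X)" "w \<in> lists (X \<union> m_inv G ` X)"
    "a = group_prod G u" "a' = group_prod G (rev u)" "b = group_prod G w" "b' = group_prod G (rev w)"
    using ab by (auto simp: reversal_pairs_def)
  show ?thesis
    unfolding reversal_pairs_def
    by (rule image_eqI [where x = "u @ w"])
      (use uw letters_carrier [OF X uw(1)] letters_carrier [OF X uw(2)] in
        \<open>simp_all add: group_prod_append\<close>)
qed

lemma reversal_pairs_closed:
  assumes "X \<subseteq> carrier G" "(a, a') \<in> reversal_pairs G X"
  shows "a \<in> carrier G" "a' \<in> carrier G"
  using assms(2) by (auto simp: reversal_pairs_def dest!: letters_carrier [OF assms(1)] intro: group_prod_closed)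

text \<open>Each element of the generated subgroup is the value of some word, and that word can be
  reversed. One-letter words are their own reversals, and products of words reverse in the opposite
  order.\<close>

lemma reversal_pairs_total:
  assumes "X \<subseteq> carrier G" "a \<in> generate G X"
  shows "\<exists>a'. (a, a') \<in> reversal_pairs G X"
  using assms(2)
  by induction (use reversal_pairs_one reversal_pairs_letter [OF assms(1)]
      reversal_pairs_mult [OF assms(1)] in blast)+

lemma palindromic_carrier:
  assumes "X \<subseteq> carrier G"
  shows "palindromic G X \<subseteq> carrier G"
proof (rule image_subsetI)
  fix w assume "w \<in> palindromes G X"
  then have "w \<in> lists (X \<union> m_inv G ` X)"
    by (simp only: palindromes_def mem_Collect_eq)
  then show "group_prod G w \<in> carrier G"
    using assms by (intro group_prod_closed letters_carrier)
qed

lemma palindromic_one: "\<one> \<in> palindromic G X"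
  by (rule image_eqI [where x = "[]"]) (auto simp: palindromes_def)

lemma palindromic_letter:
  assumes "X \<subseteq> carrier G" "x \<in> X \<union> m_inv G ` X"
  shows "x \<in> palindromic G X"
  by (rule image_eqI [where x = "[x]"]) (use assms in \<open>auto simp: palindromes_def\<close>)

text \<open>If \<open>w\<close> is a palindrome, so is \<open>u @ w @ rev u\<close>. Palindromes of
  the wreath product are built outwards from a centre in this way.\<close>

lemma palindromic_sandwich:
  assumes X: "X \<subseteq> carrier G" and u: "(a, a') \<in> reversal_pairs G X" and p: "p \<in> palindromic G X"
  shows "a \<otimes> p \<otimes> a' \<in> palindromic G X"
proof -
  obtain u w where uw: "u \<in> lists (X \<union> m_inv G ` X)" "w \<in> lists (X \<union> m_inv G ` X)" "rev w = w"
    "a = group_prod G u" "a' = group_prod G (rev u)" "p = group_prod G w"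
    using u p by (auto simp: reversal_pairs_def palindromes_def)
  note uc = letters_carrier [OF X uw(1)] and wc = letters_carrier [OF X uw(2)]
  show ?thesis
  proof (rule image_eqI)
    show "u @ w @ rev u \<in> palindromes G X"
      using uw(1-3) by (auto simp: palindromes_def)
    have "set (w @ rev u) \<subseteq> carrier G"
      using uc wc by simp
    then have "group_prod G (u @ w @ rev u) = group_prod G u \<otimes> (group_prod G w \<otimes> group_prod G (rev u))"
      using uc wc by (simp only: group_prod_append)
    then show "a \<otimes> p \<otimes> a' = group_prod G (u @ w @ rev u)"
      using group_prod_closed uc wc uw(4-6) by (simp only: m_assoc)
  qed
qed

lemma palindromic_nat_pow:
  assumes X: "X \<subseteq> carrier G" and x: "x \<in> X \<union> m_inv G ` X"
  shows "x [^] (n :: nat) \<in> palindromic G X"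
proof (rule image_eqI [where x = "replicate n x"])
  have "x \<in> carrier G"
    using assms by auto
  then show "x [^] n = group_prod G (replicate n x)"
  proof (induction n)
    case (Suc n)
    then show ?case
      by (simp only: nat_pow_Suc2 replicate_Suc group_prod_Cons)
  qed simp
qed (use x in \<open>auto simp: palindromes_def\<close>)

lemma palindromic_int_pow:
  assumes X: "X \<subseteq> carrier G" and x: "x \<in> X"
  shows "x [^] (k :: int) \<in> palindromic G X"
proof (cases k rule: int_cases2)
  case (nonneg n)
  have "x [^] n \<in> palindromic G X"
    using assms by (intro palindromic_nat_pow) auto
  then show ?thesis
    by (simp only: nonneg int_pow_int)
next
  case (nonpos n)
  have "x \<in> carrier G"
    using assms by blast
  moreover have "(inv x) [^] n \<in> palindromic G X"
    using assms by (intro palindromic_nat_pow) auto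
  ultimately show ?thesis
    by (simp only: nonpos int_pow_neg_int nat_pow_inv)
qed

lemma palindrome_products_one: "\<one> \<in> palindrome_products G X n"
  unfolding palindrome_products_def by (intro CollectI exI [of _ "[]"]) auto

lemma palindrome_products_palindromic:
  assumes "X \<subseteq> carrier G" "p \<in> palindromic G X"
  shows "p \<in> palindrome_products G X 1"
proof -
  have "p \<in> carrier G"
    using palindromic_carrier [OF assms(1)] assms(2) by (rule subsetD)
  then have "p = group_prod G [p]"
    by simp
  moreover have "length [p] \<le> 1" "set [p] \<subseteq> palindromic G X"
    using assms(2) by simp_all
  ultimately show ?thesis
    unfolding palindrome_products_def by blast
qed

lemma palindrome_products_mult:
  assumes X: "X \<subseteq> carrier G"
    and a: "a \<in> palindrome_products G X m" and b: "b \<in> palindrome_products G X n"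
  shows "a \<otimes> b \<in> palindrome_products G X (m + n)"
proof -
  obtain ps where ps: "length ps \<le> m" "set ps \<subseteq> palindromic G X" "a = group_prod G ps"
    using a unfolding palindrome_products_def by blast
  obtain qs where qs: "length qs \<le> n" "set qs \<subseteq> palindromic G X" "b = group_prod G qs"
    using b unfolding palindrome_products_def by blast
  have "a \<otimes> b = group_prod G (ps @ qs)"
    unfolding ps(3) qs(3)
    by (intro group_prod_append [symmetric] subset_trans [OF _ palindromic_carrier [OF X]] ps(2) qs(2))
  moreover have "length (ps @ qs) \<le> m + n" "set (ps @ qs) \<subseteq> palindromic G X"
    using ps(1,2) qs(1,2) by simp_all
  ultimately show ?thesis
    unfolding palindrome_products_def by blast
qed

end

section \<open>Words in abelian groups\<close>

text \<open>Reversing a word only permutes its letters. Applied to \<open>H\<close>, this allows the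
  same displacement to be put on both sides of a palindrome.\<close>

lemma (in comm_group) reversal_pairs_self:
  assumes "X \<subseteq> carrier G" "a \<in> generate G X"
  shows "(a, a) \<in> reversal_pairs G X"
  using assms(2)
proof induction
  case (eng a b)
  then show ?case
    using reversal_pairs_mult [OF assms(1) eng.IH] generate_in_carrier [OF assms(1)]
    by (simp add: m_comm)
qed (use reversal_pairs_one reversal_pairs_letter [OF assms(1)] in auto)

text \<open>In an abelian group the product of the subgroups generated by \<open>{x}\<close> and by
  \<open>X\<close> is again a subgroup, and it contains \<open>insert x X\<close>.\<close>

lemma (in comm_group) generate_insert:
  assumes "insert x X \<subseteq> carrier G" "a \<in> generate G (insert x X)"
  shows "\<exists>k :: int. \<exists>b \<in> generate G X. a = x [^] k \<otimes> b"
proof -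
  have sub: "subgroup (generate G {x} <#> generate G X) G"
    using assms(1) by (intro mult_subgroups generate_is_subgroup) auto
  have "insert x X \<subseteq> generate G {x} <#> generate G X"
  proof
    fix y assume "y \<in> insert x X"
    then have "y = x \<otimes> \<one> \<or> y \<in> X \<and> y = \<one> \<otimes> y"
      using assms(1) by auto
    then show "y \<in> generate G {x} <#> generate G X"
      unfolding set_mult_def by (auto intro: generate.intros)
  qed
  then have "a \<in> generate G {x} <#> generate G X"
    using generate_subgroup_incl [OF _ sub] assms(2) by blast
  moreover have "generate G {x} = {x [^] (k :: int) | k. k \<in> UNIV}"
    using generate_pow [of x] assms(1) by auto
  ultimately show ?thesis
    by (auto simp: set_mult_def)
qed

section \<open>Images of words under homomorphisms\<close>

context group_hom
begin

lemma group_prod_map: "set w \<subseteq> carrier G \<Longrightarrow> group_prod H (map h w) = h (group_prod G w)"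
  by (induction w) (auto simp: G.group_prod_closed)

lemma map_letters:
  assumes "X \<subseteq> carrier G" "h ` X \<subseteq> Y" "w \<in> lists (X \<union> m_inv G ` X)"
  shows "map h w \<in> lists (Y \<union> m_inv H ` Y)"
proof -
  have "h x \<in> Y \<union> m_inv H ` Y" if "x \<in> X \<union> m_inv G ` X" for x
    using that assms(1,2) by (auto simp: subset_iff)
  then show ?thesis
    using assms(3) by (auto simp: in_lists_conv_set)
qed

lemma reversal_pairs_image:
  assumes X: "X \<subseteq> carrier G" "h ` X \<subseteq> Y" and "(a, b) \<in> reversal_pairs G X"
  shows "(h a, h b) \<in> reversal_pairs H Y"
proof -
  obtain w where w: "w \<in> lists (X \<union> m_inv G ` X)" "a = group_prod G w" "b = group_prod G (rev w)"
    using assms(3) by (auto simp: reversal_pairs_def)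
  note wc = G.letters_carrier [OF X(1) w(1)]
  have "(h a, h b) = (group_prod H (map h w), group_prod H (rev (map h w)))"
    unfolding rev_map w(2,3) using wc by (simp only: group_prod_map)
  then show ?thesis
    unfolding reversal_pairs_def using map_letters [OF X w(1)] by (rule image_eqI)
qed

lemma palindromic_image:
  assumes X: "X \<subseteq> carrier G" "h ` X \<subseteq> Y" and "p \<in> palindromic G X"
  shows "h p \<in> palindromic H Y"
proof -
  obtain w where w: "w \<in> lists (X \<union> m_inv G ` X)" "rev w = w" "p = group_prod G w"
    using assms(3) by (auto simp: palindromes_def)
  have "map h w \<in> palindromes H Y"
    using map_letters [OF X w(1)] w(2) by (simp add: palindromes_def rev_map)
  moreover have "h p = group_prod H (map h w)"
    unfolding w(3) using G.letters_carrier(1) [OF X(1) w(1)] by (simp only: group_prod_map)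
  ultimately show ?thesis
    by blast
qed

end

section \<open>Wreath products\<close>

definition single ::
  "('a, 'b) monoid_scheme \<Rightarrow> ('h, 'c) monoid_scheme \<Rightarrow> 'h \<Rightarrow> 'a \<Rightarrow> ('h \<Rightarrow> 'a) \<times> 'h" where
  "single G H x a = ((\<lambda>y \<in> carrier H. if y = x then a else \<one>\<^bsub>G\<^esub>), \<one>\<^bsub>H\<^esub>)"

lemma wreath_base_eq_single: "wreath_base G H = single G H \<one>\<^bsub>H\<^esub>"
  by (auto simp: wreath_base_def single_def)

locale wreath_product = G: group G + H: comm_group H
  for G :: "('a, 'b) monoid_scheme" and H :: "('h, 'c) monoid_scheme"
begin

abbreviation W where "W \<equiv> wreath G H"

abbreviation single_W where "single_W \<equiv> single G H"

abbreviation top_W where "top_W \<equiv> wreath_top G H"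

sublocale W: group W
  by (rule group_wreath) (rule G.group_axioms H.group_axioms)+

section \<open>The base group, which is the kernel of the projection onto \<open>H\<close>\<close>

definition base_W where "base_W = {w \<in> carrier W. snd w = \<one>\<^bsub>H\<^esub>}"

lemma base_W_iff:
  "(f, v) \<in> base_W \<longleftrightarrow> v = \<one>\<^bsub>H\<^esub> \<and> f \<in> carrier H \<rightarrow>\<^sub>E carrier G \<and> finite {x \<in> carrier H. f x \<noteq> \<one>\<^bsub>G\<^esub>}"
  unfolding base_W_def carrier_wreath [OF G.group_axioms] by auto

lemma base_W_carrier: "h \<in> base_W \<Longrightarrow> h \<in> carrier W"
  by (simp add: base_W_def)

lemma base_W_one: "\<one>\<^bsub>W\<^esub> \<in> base_W"
  using W.one_closed by (simp add: base_W_def one_wreath)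

lemma base_W_mult:
  assumes "h \<in> base_W" "k \<in> base_W"
  shows "h \<otimes>\<^bsub>W\<^esub> k \<in> base_W"
proof -
  have "h \<otimes>\<^bsub>W\<^esub> k \<in> carrier W"
    using assms by (simp add: base_W_def)
  then show ?thesis
    using assms by (cases h; cases k) (simp add: base_W_def mult_wreath)
qed

lemma mult_base_W:
  "(f, \<one>\<^bsub>H\<^esub>) \<otimes>\<^bsub>W\<^esub> (g, \<one>\<^bsub>H\<^esub>) = ((\<lambda>x \<in> carrier H. f x \<otimes>\<^bsub>G\<^esub> g x), \<one>\<^bsub>H\<^esub>)"
  by (auto simp: mult_wreath shift_def)

lemma single_base_W: "x \<in> carrier H \<Longrightarrow> a \<in> carrier G \<Longrightarrow> single_W x a \<in> base_W"
  unfolding single_def base_W_iff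
  by (auto intro: finite_subset [of _ "{x}"])

lemma single_closed [simp]: "x \<in> carrier H \<Longrightarrow> a \<in> carrier G \<Longrightarrow> single_W x a \<in> carrier W"
  using single_base_W base_W_carrier by blast

lemma single_one: "single_W x \<one>\<^bsub>G\<^esub> = \<one>\<^bsub>W\<^esub>"
  by (auto simp: single_def one_wreath)

lemma single_mult:
  assumes "a \<in> carrier G" "b \<in> carrier G"
  shows "single_W x a \<otimes>\<^bsub>W\<^esub> single_W x b = single_W x (a \<otimes>\<^bsub>G\<^esub> b)"
  unfolding single_def mult_base_W using assms by (auto intro!: restrict_ext)

lemma single_commute:
  assumes "x \<noteq> y" "a \<in> carrier G" "b \<in> carrier G"
  shows "single_W x a \<otimes>\<^bsub>W\<^esub> single_W y b = single_W y b \<otimes>\<^bsub>W\<^esub> single_W x a"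
  unfolding single_def mult_base_W using assms by (auto intro!: restrict_ext)

text \<open>Each coordinate copy of \<open>G\<close> is normal in the base group: conjugation by
  \<open>h\<close> acts at \<open>x\<close> as conjugation by the value of \<open>h\<close> at
  \<open>x\<close>.\<close>

lemma single_past_base:
  assumes "h \<in> base_W" "x \<in> carrier H" "a \<in> carrier G"
  obtains b where "b \<in> carrier G" "h \<otimes>\<^bsub>W\<^esub> single_W x a = single_W x b \<otimes>\<^bsub>W\<^esub> h"
proof -
  obtain f where f: "h = (f, \<one>\<^bsub>H\<^esub>)" "f \<in> carrier H \<rightarrow>\<^sub>E carrier G"
    using assms(1) by (cases h) (simp add: base_W_iff)
  have closed: "f y \<in> carrier G" if "y \<in> carrier H" for y
    using f(2) that by auto
  show thesis
  proof
    show "f x \<otimes>\<^bsub>G\<^esub> a \<otimes>\<^bsub>G\<^esub> inv\<^bsub>G\<^esub> f x \<in> carrier G"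
      using closed assms by simp
    show "h \<otimes>\<^bsub>W\<^esub> single_W x a = single_W x (f x \<otimes>\<^bsub>G\<^esub> a \<otimes>\<^bsub>G\<^esub> inv\<^bsub>G\<^esub> f x) \<otimes>\<^bsub>W\<^esub> h"
      unfolding single_def f(1) mult_base_W using closed assms
      by (auto simp: G.m_assoc intro!: restrict_ext)
  qed
qed

lemma base_past_single:
  assumes "h \<in> base_W" "x \<in> carrier H" "a \<in> carrier G"
  obtains b where "b \<in> carrier G" "single_W x a \<otimes>\<^bsub>W\<^esub> h = h \<otimes>\<^bsub>W\<^esub> single_W x b"
proof -
  obtain f where f: "h = (f, \<one>\<^bsub>H\<^esub>)" "f \<in> carrier H \<rightarrow>\<^sub>E carrier G"
    using assms(1) by (cases h) (simp add: base_W_iff)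
  have closed: "f y \<in> carrier G" if "y \<in> carrier H" for y
    using f(2) that by auto
  show thesis
  proof
    show "inv\<^bsub>G\<^esub> f x \<otimes>\<^bsub>G\<^esub> (a \<otimes>\<^bsub>G\<^esub> f x) \<in> carrier G"
      using closed assms by simp
    show "single_W x a \<otimes>\<^bsub>W\<^esub> h = h \<otimes>\<^bsub>W\<^esub> single_W x (inv\<^bsub>G\<^esub> f x \<otimes>\<^bsub>G\<^esub> (a \<otimes>\<^bsub>G\<^esub> f x))"
      unfolding single_def f(1) mult_base_W using closed assms
      by (auto simp flip: G.m_assoc intro!: restrict_ext)
  qed
qed

text \<open>A finitely supported function is a finite product of functions supported at one
  point.\<close>

lemma base_W_induct [consumes 1, case_names one single]:
  assumes h: "h \<in> base_W" and one: "P \<one>\<^bsub>W\<^esub>"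
    and single: "\<And>g x a. g \<in> base_W \<Longrightarrow> x \<in> carrier H \<Longrightarrow> a \<in> carrier G \<Longrightarrow> P g \<Longrightarrow>
      P (g \<otimes>\<^bsub>W\<^esub> single_W x a)"
  shows "P h"
proof -
  \<comment> \<open>\<open>F\<close> only has to contain the support, so the induction hypothesis
    applies to every function that vanishes outside the smaller set.\<close>
  have "P (f, \<one>\<^bsub>H\<^esub>)" if "finite F" "f \<in> carrier H \<rightarrow>\<^sub>E carrier G" "{x \<in> carrier H. f x \<noteq> \<one>\<^bsub>G\<^esub>} \<subseteq> F" for f F
    using that
  proof (induction F arbitrary: f rule: finite_induct)
    case empty
    then have "f = (\<lambda>x \<in> carrier H. \<one>\<^bsub>G\<^esub>)"
      by (intro PiE_ext [of f "carrier H" "\<lambda>_. carrier G"]) auto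
    then show ?case
      using one by (simp only: one_wreath)
  next
    case (insert x F)
    show ?case
    proof (cases "x \<in> carrier H")
      case False
      then have "{y \<in> carrier H. f y \<noteq> \<one>\<^bsub>G\<^esub>} \<subseteq> F"
        using insert.prems(2) by blast
      then show ?thesis
        using insert by blast
    next
      case True
      have closed: "f y \<in> carrier G" if "y \<in> carrier H" for y
        using insert.prems(1) that by auto
      \<comment> \<open>\<open>g\<close> is \<open>f\<close> with its value at \<open>x\<close>
        erased; multiplying by \<open>single_W x (f x)\<close> restores it.\<close>
      define g where "g = (\<lambda>y \<in> carrier H. if y = x then \<one>\<^bsub>G\<^esub> else f y)"
      have g: "g \<in> carrier H \<rightarrow>\<^sub>E carrier G" "{y \<in> carrier H. g y \<noteq> \<one>\<^bsub>G\<^esub>} \<subseteq> F"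
        using closed insert.prems(2) by (auto simp: g_def)
      moreover have "finite {y \<in> carrier H. g y \<noteq> \<one>\<^bsub>G\<^esub>}"
        using g(2) insert.hyps(1) by (rule finite_subset)
      ultimately have "(g, \<one>\<^bsub>H\<^esub>) \<in> base_W" "P (g, \<one>\<^bsub>H\<^esub>)"
        using insert.IH by (auto simp: base_W_iff)
      then have "P ((g, \<one>\<^bsub>H\<^esub>) \<otimes>\<^bsub>W\<^esub> single_W x (f x))"
        using True closed by (intro single)
      also have "(g, \<one>\<^bsub>H\<^esub>) \<otimes>\<^bsub>W\<^esub> single_W x (f x) = ((\<lambda>y \<in> carrier H. f y), \<one>\<^bsub>H\<^esub>)"
        unfolding single_def mult_base_W using closed by (auto simp: g_def intro!: restrict_ext)
      also have "(\<lambda>y \<in> carrier H. f y) = f"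
        using insert.prems(1) by (rule PiE_restrict)
      finally show ?thesis .
    qed
  qed
  then show ?thesis
    using h by (cases h) (auto simp: base_W_iff)
qed

section \<open>The top group and its action by translation\<close>

lemma top_closed [simp]: "v \<in> carrier H \<Longrightarrow> top_W v \<in> carrier W"
  by (auto simp: wreath_top_def carrier_wreath [OF G.group_axioms] cong: conj_cong)

lemma top_one: "top_W \<one>\<^bsub>H\<^esub> = \<one>\<^bsub>W\<^esub>"
  by (simp add: wreath_top_def one_wreath)

lemma top_mult:
  assumes "v \<in> carrier H" "w \<in> carrier H"
  shows "top_W v \<otimes>\<^bsub>W\<^esub> top_W w = top_W (v \<otimes>\<^bsub>H\<^esub> w)"
  unfolding wreath_top_def mult_wreath using assms
  by (auto simp: shift_def intro!: restrict_ext)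

lemma top_single:
  assumes "v \<in> carrier H" "x \<in> carrier H" "a \<in> carrier G"
  shows "top_W v \<otimes>\<^bsub>W\<^esub> single_W x a = single_W (v \<otimes>\<^bsub>H\<^esub> x) a \<otimes>\<^bsub>W\<^esub> top_W v"
proof -
  have "inv\<^bsub>H\<^esub> v \<otimes>\<^bsub>H\<^esub> z = x \<longleftrightarrow> z = v \<otimes>\<^bsub>H\<^esub> x" if "z \<in> carrier H" for z
    using assms that by (metis H.inv_closed H.inv_solve_left)
  then show ?thesis
    unfolding wreath_top_def single_def mult_wreath using assms
    by (auto simp: shift_def intro!: restrict_ext)
qed

lemma base_top_decomposition:
  assumes "w \<in> carrier W"
  obtains h v where "h \<in> base_W" "v \<in> carrier H" "w = h \<otimes>\<^bsub>W\<^esub> top_W v"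
proof -
  obtain f v where w: "w = (f, v)" "v \<in> carrier H" "f \<in> carrier H \<rightarrow>\<^sub>E carrier G"
    "finite {x \<in> carrier H. f x \<noteq> \<one>\<^bsub>G\<^esub>}"
    using assms by (auto simp: carrier_wreath [OF G.group_axioms])
  show thesis
  proof
    show "(f, \<one>\<^bsub>H\<^esub>) \<in> base_W"
      using w by (simp add: base_W_iff)
    have "(\<lambda>x \<in> carrier H. f x \<otimes>\<^bsub>G\<^esub> shift H \<one>\<^bsub>H\<^esub> (\<lambda>x \<in> carrier H. \<one>\<^bsub>G\<^esub>) x) = (\<lambda>x \<in> carrier H. f x)"
      by (rule restrict_ext) (use w(3) in \<open>auto simp: shift_def intro!: G.r_one\<close>)
    also have "\<dots> = f"
      using w(3) by (rule PiE_restrict)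
    finally show "w = (f, \<one>\<^bsub>H\<^esub>) \<otimes>\<^bsub>W\<^esub> top_W v"
      unfolding wreath_top_def mult_wreath using w(1,2) by (simp only: H.l_one)
  qed (rule w(2))
qed

lemma group_hom_single: "x \<in> carrier H \<Longrightarrow> group_hom G W (single_W x)"
  by (intro group_hom.intro group_hom_axioms.intro homI) (auto simp: single_mult)

lemma group_hom_top: "group_hom H W top_W"
  by (intro group_hom.intro group_hom_axioms.intro homI) (auto simp: top_mult)

end

section \<open>Palindromes in wreath products with abelian top group\<close>

locale generated_wreath_product = wreath_product +
  fixes A S
  assumes A_carrier: "A \<subseteq> carrier G" and generate_A: "generate G A = carrier G"
    and S_carrier: "S \<subseteq> carrier H" and finite_S: "finite S" and generate_S: "generate H S = carrier H"
begin

definition gens where "gens = wreath_base G H ` A \<union> top_W ` S"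

lemma gens_carrier: "gens \<subseteq> carrier W"
  using A_carrier S_carrier by (auto simp: gens_def wreath_base_eq_single)

lemma single_one_image: "single_W \<one>\<^bsub>H\<^esub> ` A \<subseteq> gens"
  by (simp add: gens_def wreath_base_eq_single)

lemma top_image: "top_W ` S \<subseteq> gens"
  by (simp add: gens_def)

section \<open>Reversals in the wreath product\<close>

lemma top_reversal: "v \<in> carrier H \<Longrightarrow> (top_W v, top_W v) \<in> reversal_pairs W gens"
  using H.reversal_pairs_self [OF S_carrier] generate_S
  by (intro group_hom.reversal_pairs_image [OF group_hom_top S_carrier top_image]) auto

text \<open>To place \<open>a\<close> at \<open>y\<close>, walk to \<open>y\<close>, leave
  \<open>a\<close> there and walk back. Reversing this word keeps the order of the displacements
  \<open>y\<close> and \<open>-y\<close> as opposite ends, so they swap: the walk now visits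
  \<open>-y\<close> and leaves \<open>a'\<close> there.\<close>

lemma single_reversal:
  assumes a: "(a, a') \<in> reversal_pairs G A" and y: "y \<in> carrier H"
  shows "(single_W y a, single_W (inv\<^bsub>H\<^esub> y) a') \<in> reversal_pairs W gens"
proof -
  note aG = G.reversal_pairs_closed [OF A_carrier a]
  have conj: "top_W z \<otimes>\<^bsub>W\<^esub> single_W \<one>\<^bsub>H\<^esub> b \<otimes>\<^bsub>W\<^esub> top_W (inv\<^bsub>H\<^esub> z) = single_W z b"
    if "z \<in> carrier H" "b \<in> carrier G" for z b
    using that by (simp add: top_single W.m_assoc top_mult top_one)
  have "(top_W y \<otimes>\<^bsub>W\<^esub> single_W \<one>\<^bsub>H\<^esub> a \<otimes>\<^bsub>W\<^esub> top_W (inv\<^bsub>H\<^esub> y),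
      top_W (inv\<^bsub>H\<^esub> y) \<otimes>\<^bsub>W\<^esub> (single_W \<one>\<^bsub>H\<^esub> a' \<otimes>\<^bsub>W\<^esub> top_W y)) \<in> reversal_pairs W gens"
    using y a by (intro W.reversal_pairs_mult [OF gens_carrier] top_reversal
        group_hom.reversal_pairs_image [OF group_hom_single A_carrier single_one_image]) auto
  then show ?thesis
    using conj [of y a] conj [of "inv\<^bsub>H\<^esub> y" a'] aG y by (simp add: W.m_assoc)
qed

section \<open>Base elements carried by a single palindrome\<close>

text \<open>The functions left behind by palindromic walks with total displacement \<open>c\<close>;
  the factor \<open>top_W c\<close> records that displacement.\<close>

definition symmetric_about where
  "symmetric_about c = {g \<in> base_W. g \<otimes>\<^bsub>W\<^esub> top_W c \<in> palindromic W gens}"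

text \<open>
  Elements that remain symmetric about \<open>\<one>\<close> after any palindrome of \<open>G\<close> is placed at \<open>\<one>\<close>. This lets
  the last correcting palindrome also carry the first palindromic factor of the value left at \<open>\<one>\<close>.
\<close>
definition extendable where
  "extendable = {d \<in> base_W. \<forall>p \<in> palindromic G A. d \<otimes>\<^bsub>W\<^esub> single_W \<one>\<^bsub>H\<^esub> p \<in> symmetric_about \<one>\<^bsub>H\<^esub>}"

lemma single_one_palindromic:
  "p \<in> palindromic G A \<Longrightarrow> single_W \<one>\<^bsub>H\<^esub> p \<in> palindromic W gens"
  by (rule group_hom.palindromic_image [OF group_hom_single A_carrier single_one_image]) auto

lemma single_one_symmetric:
  assumes "p \<in> palindromic G A"
  shows "single_W \<one>\<^bsub>H\<^esub> p \<in> symmetric_about \<one>\<^bsub>H\<^esub>"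
proof -
  have "p \<in> carrier G"
    using G.palindromic_carrier [OF A_carrier] assms by blast
  then show ?thesis
    using single_one_palindromic [OF assms]
    by (simp add: symmetric_about_def top_one single_base_W)
qed

lemma one_symmetric:
  assumes "s \<in> S"
  shows "\<one>\<^bsub>W\<^esub> \<in> symmetric_about s"
proof -
  have "top_W s \<in> palindromic W gens"
    using assms top_image by (intro W.palindromic_letter [OF gens_carrier]) auto
  moreover have "\<one>\<^bsub>W\<^esub> \<otimes>\<^bsub>W\<^esub> top_W s = top_W s"
    using assms S_carrier by (intro W.l_one top_closed) auto
  ultimately show ?thesis
    by (simp only: symmetric_about_def base_W_one mem_Collect_eq simp_thms)
qed

lemma one_extendable: "\<one>\<^bsub>W\<^esub> \<in> extendable"
proof -
  have "\<one>\<^bsub>W\<^esub> \<otimes>\<^bsub>W\<^esub> single_W \<one>\<^bsub>H\<^esub> p \<in> symmetric_about \<one>\<^bsub>H\<^esub>" if "p \<in> palindromic G A" for p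
  proof -
    have "p \<in> carrier G"
      using G.palindromic_carrier [OF A_carrier] that by blast
    then show ?thesis
      using single_one_symmetric [OF that] by simp
  qed
  then show ?thesis
    by (simp add: extendable_def base_W_one)
qed

text \<open>The palindrome for \<open>g\<close> is enclosed between \<open>single_W y a\<close> and
  its reversal, which sits at \<open>-y\<close>. Commuting the latter to the left past
  \<open>top_W c\<close> translates it to \<open>c - y\<close>.\<close>

lemma symmetric_sandwich:
  assumes g: "g \<in> symmetric_about c" and c: "c \<in> carrier H"
    and a: "(a, a') \<in> reversal_pairs G A" and y: "y \<in> carrier H"
  shows "single_W y a \<otimes>\<^bsub>W\<^esub> g \<otimes>\<^bsub>W\<^esub> single_W (c \<otimes>\<^bsub>H\<^esub> inv\<^bsub>H\<^esub> y) a' \<in> symmetric_about c"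
proof -
  note aG = G.reversal_pairs_closed [OF A_carrier a]
  have gB: "g \<in> base_W" "g \<in> carrier W"
    using g base_W_carrier by (auto simp: symmetric_about_def)
  have "single_W y a \<otimes>\<^bsub>W\<^esub> (g \<otimes>\<^bsub>W\<^esub> top_W c) \<otimes>\<^bsub>W\<^esub> single_W (inv\<^bsub>H\<^esub> y) a' \<in> palindromic W gens"
    using g by (intro W.palindromic_sandwich [OF gens_carrier] single_reversal a y)
      (simp add: symmetric_about_def)
  also have "single_W y a \<otimes>\<^bsub>W\<^esub> (g \<otimes>\<^bsub>W\<^esub> top_W c) \<otimes>\<^bsub>W\<^esub> single_W (inv\<^bsub>H\<^esub> y) a' =
      single_W y a \<otimes>\<^bsub>W\<^esub> g \<otimes>\<^bsub>W\<^esub> (top_W c \<otimes>\<^bsub>W\<^esub> single_W (inv\<^bsub>H\<^esub> y) a')"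
    using gB aG c y by (simp add: W.m_assoc)
  also have "\<dots> = single_W y a \<otimes>\<^bsub>W\<^esub> g \<otimes>\<^bsub>W\<^esub> single_W (c \<otimes>\<^bsub>H\<^esub> inv\<^bsub>H\<^esub> y) a' \<otimes>\<^bsub>W\<^esub> top_W c"
    using gB aG c y by (simp add: top_single W.m_assoc)
  finally show ?thesis
    using gB aG c y by (simp add: symmetric_about_def base_W_mult single_base_W)
qed

section \<open>Moving values by reflections\<close>

text \<open>
  The value that \<open>t\<^sup>-\<^sup>1h\<close> takes at \<open>y\<close> can be pushed to the mirror image \<open>c - y\<close> by changing \<open>t\<close> within \<open>T\<close>.
\<close>
definition movable where
  "movable T c \<longleftrightarrow> (\<forall>t \<in> T. \<forall>y \<in> carrier H. \<forall>a \<in> carrier G. c \<otimes>\<^bsub>H\<^esub> inv\<^bsub>H\<^esub> y \<noteq> y \<longrightarrow>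
    (\<exists>b \<in> carrier G. t \<otimes>\<^bsub>W\<^esub> single_W y a \<otimes>\<^bsub>W\<^esub> single_W (c \<otimes>\<^bsub>H\<^esub> inv\<^bsub>H\<^esub> y) b \<in> T))"

text \<open>Commuted to the left of \<open>g\<close>, the value \<open>a\<close> becomes some
  \<open>\<alpha>\<close> at \<open>y\<close>. A word for \<open>\<alpha>\<close> has a reversal
  with value \<open>\<beta>\<close>, and placing \<open>\<beta>\<close> at the mirror point
  completes the sandwich.\<close>

lemma movable_symmetric:
  assumes c: "c \<in> carrier H"
  shows "movable (symmetric_about c) c"
  unfolding movable_def
proof (intro ballI impI)
  fix g y a assume g: "g \<in> symmetric_about c" and y: "y \<in> carrier H" and a: "a \<in> carrier G"
  have gB: "g \<in> base_W"
    using g by (simp add: symmetric_about_def)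
  obtain \<alpha> where \<alpha>: "\<alpha> \<in> carrier G" "g \<otimes>\<^bsub>W\<^esub> single_W y a = single_W y \<alpha> \<otimes>\<^bsub>W\<^esub> g"
    using single_past_base [OF gB y a] .
  obtain \<beta> where \<beta>: "(\<alpha>, \<beta>) \<in> reversal_pairs G A"
    using G.reversal_pairs_total [OF A_carrier] \<alpha>(1) generate_A by blast
  have "\<beta> \<in> carrier G"
    using G.reversal_pairs_closed [OF A_carrier \<beta>] by simp
  then show "\<exists>b \<in> carrier G. g \<otimes>\<^bsub>W\<^esub> single_W y a \<otimes>\<^bsub>W\<^esub> single_W (c \<otimes>\<^bsub>H\<^esub> inv\<^bsub>H\<^esub> y) b \<in> symmetric_about c"
    using symmetric_sandwich [OF g c \<beta> y] \<alpha>(2) by auto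
qed

text \<open>The sandwich is built around \<open>d\<close> together with an arbitrary palindrome
  \<open>p\<close> at the identity; then \<open>p\<close> is commuted outwards past the new value at
  \<open>-y\<close>.\<close>

lemma movable_extendable: "movable extendable \<one>\<^bsub>H\<^esub>"
  unfolding movable_def
proof (intro ballI impI)
  fix d y a assume d: "d \<in> extendable" and y: "y \<in> carrier H" and a: "a \<in> carrier G"
    and "\<one>\<^bsub>H\<^esub> \<otimes>\<^bsub>H\<^esub> inv\<^bsub>H\<^esub> y \<noteq> y"
  \<comment> \<open>The identity is fixed by the reflection \<open>y \<mapsto> -y\<close>, so a
    point that is moved differs from it.\<close>
  then have iy: "inv\<^bsub>H\<^esub> y \<noteq> \<one>\<^bsub>H\<^esub>"
    by auto
  have dB: "d \<in> base_W" "d \<in> carrier W"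
    using d base_W_carrier by (auto simp: extendable_def)
  obtain \<alpha> where \<alpha>: "\<alpha> \<in> carrier G" "d \<otimes>\<^bsub>W\<^esub> single_W y a = single_W y \<alpha> \<otimes>\<^bsub>W\<^esub> d"
    using single_past_base [OF dB(1) y a] .
  obtain \<beta> where \<beta>: "(\<alpha>, \<beta>) \<in> reversal_pairs G A"
    using G.reversal_pairs_total [OF A_carrier] \<alpha>(1) generate_A by blast
  have \<beta>G: "\<beta> \<in> carrier G"
    using G.reversal_pairs_closed [OF A_carrier \<beta>] by simp
  have "single_W y \<alpha> \<otimes>\<^bsub>W\<^esub> d \<otimes>\<^bsub>W\<^esub> single_W (inv\<^bsub>H\<^esub> y) \<beta> \<otimes>\<^bsub>W\<^esub> single_W \<one>\<^bsub>H\<^esub> p \<in> symmetric_about \<one>\<^bsub>H\<^esub>"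
    if p: "p \<in> palindromic G A" for p
  proof -
    have pG: "p \<in> carrier G"
      using G.palindromic_carrier [OF A_carrier] p by blast
    have "single_W y \<alpha> \<otimes>\<^bsub>W\<^esub> (d \<otimes>\<^bsub>W\<^esub> single_W \<one>\<^bsub>H\<^esub> p) \<otimes>\<^bsub>W\<^esub> single_W (\<one>\<^bsub>H\<^esub> \<otimes>\<^bsub>H\<^esub> inv\<^bsub>H\<^esub> y) \<beta> \<in> symmetric_about \<one>\<^bsub>H\<^esub>"
      using d p by (intro symmetric_sandwich \<beta> y) (auto simp: extendable_def)
    also have "single_W y \<alpha> \<otimes>\<^bsub>W\<^esub> (d \<otimes>\<^bsub>W\<^esub> single_W \<one>\<^bsub>H\<^esub> p) \<otimes>\<^bsub>W\<^esub> single_W (\<one>\<^bsub>H\<^esub> \<otimes>\<^bsub>H\<^esub> inv\<^bsub>H\<^esub> y) \<beta> =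
        single_W y \<alpha> \<otimes>\<^bsub>W\<^esub> (d \<otimes>\<^bsub>W\<^esub> (single_W \<one>\<^bsub>H\<^esub> p \<otimes>\<^bsub>W\<^esub> single_W (inv\<^bsub>H\<^esub> y) \<beta>))"
      using dB \<alpha>(1) pG \<beta>G y by (simp add: W.m_assoc)
    also have "single_W \<one>\<^bsub>H\<^esub> p \<otimes>\<^bsub>W\<^esub> single_W (inv\<^bsub>H\<^esub> y) \<beta> = single_W (inv\<^bsub>H\<^esub> y) \<beta> \<otimes>\<^bsub>W\<^esub> single_W \<one>\<^bsub>H\<^esub> p"
      using iy pG \<beta>G by (metis single_commute)
    finally show ?thesis
      using dB \<alpha>(1) pG \<beta>G y by (simp add: W.m_assoc)
  qed
  then have "single_W y \<alpha> \<otimes>\<^bsub>W\<^esub> d \<otimes>\<^bsub>W\<^esub> single_W (inv\<^bsub>H\<^esub> y) \<beta> \<in> extendable"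
    using dB \<alpha>(1) \<beta>G y by (simp add: extendable_def base_W_mult single_base_W)
  then show "\<exists>b \<in> carrier G. d \<otimes>\<^bsub>W\<^esub> single_W y a \<otimes>\<^bsub>W\<^esub> single_W (\<one>\<^bsub>H\<^esub> \<otimes>\<^bsub>H\<^esub> inv\<^bsub>H\<^esub> y) b \<in> extendable"
    using \<alpha>(2) \<beta>G y by auto
qed

lemma movable_mult_left:
  assumes "movable T c" and T: "T \<subseteq> base_W" and K: "K \<subseteq> base_W" and c: "c \<in> carrier H"
  shows "movable (K <#>\<^bsub>W\<^esub> T) c"
  unfolding movable_def
proof (intro ballI impI)
  fix g y a assume g: "g \<in> K <#>\<^bsub>W\<^esub> T" and y: "y \<in> carrier H" and a: "a \<in> carrier G"
    and ne: "c \<otimes>\<^bsub>H\<^esub> inv\<^bsub>H\<^esub> y \<noteq> y"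
  obtain k t where kt: "k \<in> K" "t \<in> T" "g = k \<otimes>\<^bsub>W\<^esub> t"
    using g by (auto simp: set_mult_def)
  then have kt': "k \<in> carrier W" "t \<in> carrier W"
    using T K base_W_carrier by blast+
  obtain b where b: "b \<in> carrier G"
    "t \<otimes>\<^bsub>W\<^esub> single_W y a \<otimes>\<^bsub>W\<^esub> single_W (c \<otimes>\<^bsub>H\<^esub> inv\<^bsub>H\<^esub> y) b \<in> T"
    using assms(1) kt(2) y a ne unfolding movable_def by blast
  have "g \<otimes>\<^bsub>W\<^esub> single_W y a \<otimes>\<^bsub>W\<^esub> single_W (c \<otimes>\<^bsub>H\<^esub> inv\<^bsub>H\<^esub> y) b =
      k \<otimes>\<^bsub>W\<^esub> (t \<otimes>\<^bsub>W\<^esub> single_W y a \<otimes>\<^bsub>W\<^esub> single_W (c \<otimes>\<^bsub>H\<^esub> inv\<^bsub>H\<^esub> y) b)"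
    using kt(3) kt' y a b(1) c by (simp add: W.m_assoc)
  then show "\<exists>b \<in> carrier G. g \<otimes>\<^bsub>W\<^esub> single_W y a \<otimes>\<^bsub>W\<^esub> single_W (c \<otimes>\<^bsub>H\<^esub> inv\<^bsub>H\<^esub> y) b \<in> K <#>\<^bsub>W\<^esub> T"
    using b kt(1) unfolding set_mult_def by auto
qed

text \<open>The new values have to pass through the right factor \<open>k\<close>. This conjugates
  them but leaves them at their points, so \<open>T\<close> is applied to the conjugated value and
  its answer is conjugated back.\<close>

lemma movable_mult_right:
  assumes "movable T c" and T: "T \<subseteq> base_W" and K: "K \<subseteq> base_W" and c: "c \<in> carrier H"
  shows "movable (T <#>\<^bsub>W\<^esub> K) c"
  unfolding movable_def
proof (intro ballI impI)
  fix g y a assume g: "g \<in> T <#>\<^bsub>W\<^esub> K" and y: "y \<in> carrier H" and a: "a \<in> carrier G"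
    and ne: "c \<otimes>\<^bsub>H\<^esub> inv\<^bsub>H\<^esub> y \<noteq> y"
  let ?z = "c \<otimes>\<^bsub>H\<^esub> inv\<^bsub>H\<^esub> y"
  have z: "?z \<in> carrier H"
    using c y by simp
  obtain k t where kt: "k \<in> K" "t \<in> T" "g = t \<otimes>\<^bsub>W\<^esub> k"
    using g by (auto simp: set_mult_def)
  then have kB: "k \<in> base_W" and kt': "k \<in> carrier W" "t \<in> carrier W"
    using T K base_W_carrier by blast+
  obtain a' where a': "a' \<in> carrier G" "k \<otimes>\<^bsub>W\<^esub> single_W y a = single_W y a' \<otimes>\<^bsub>W\<^esub> k"
    using single_past_base [OF kB y a] .
  obtain b' where b': "b' \<in> carrier G" "t \<otimes>\<^bsub>W\<^esub> single_W y a' \<otimes>\<^bsub>W\<^esub> single_W ?z b' \<in> T"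
    using assms(1) kt(2) y a'(1) ne unfolding movable_def by blast
  obtain b where b: "b \<in> carrier G" "single_W ?z b' \<otimes>\<^bsub>W\<^esub> k = k \<otimes>\<^bsub>W\<^esub> single_W ?z b"
    using base_past_single [OF kB z b'(1)] .
  have "g \<otimes>\<^bsub>W\<^esub> single_W y a \<otimes>\<^bsub>W\<^esub> single_W ?z b = t \<otimes>\<^bsub>W\<^esub> (k \<otimes>\<^bsub>W\<^esub> single_W y a) \<otimes>\<^bsub>W\<^esub> single_W ?z b"
    using kt(3) kt' y a z b(1) by (simp add: W.m_assoc)
  also have "\<dots> = t \<otimes>\<^bsub>W\<^esub> single_W y a' \<otimes>\<^bsub>W\<^esub> (k \<otimes>\<^bsub>W\<^esub> single_W ?z b)"
    unfolding a'(2) using kt' y a'(1) z b(1) by (simp add: W.m_assoc)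
  also have "\<dots> = t \<otimes>\<^bsub>W\<^esub> single_W y a' \<otimes>\<^bsub>W\<^esub> single_W ?z b' \<otimes>\<^bsub>W\<^esub> k"
    unfolding b(2) [symmetric] using kt' y a'(1) z b'(1) by (simp add: W.m_assoc)
  finally show "\<exists>b \<in> carrier G. g \<otimes>\<^bsub>W\<^esub> single_W y a \<otimes>\<^bsub>W\<^esub> single_W ?z b \<in> T <#>\<^bsub>W\<^esub> K"
    using b(1) b'(2) kt(1) unfolding set_mult_def by auto
qed

section \<open>Gathering all values at the identity of \<open>H\<close>\<close>

text \<open>The points whose values can be pushed to the identity are closed under the available
  reflections. Reflecting about the identity and then about \<open>s\<close> is translation by
  \<open>s\<close>, and these translations reach every point because \<open>S\<close> generates
  \<open>H\<close>.\<close>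

lemma push_to_one:
  assumes T: "T \<subseteq> base_W" and one: "movable T \<one>\<^bsub>H\<^esub>" and mov: "\<And>s. s \<in> S \<Longrightarrow> movable T s"
    and t: "t \<in> T" and x: "x \<in> carrier H" and a: "a \<in> carrier G"
  shows "\<exists>b \<in> carrier G. t \<otimes>\<^bsub>W\<^esub> single_W x a \<otimes>\<^bsub>W\<^esub> single_W \<one>\<^bsub>H\<^esub> b \<in> T"
proof -
  \<comment> \<open>All \<open>t\<close> and \<open>a\<close> are quantified because a reflection
    step changes both before \<open>P\<close> is used again.\<close>
  define P where "P y \<longleftrightarrow> (\<forall>t \<in> T. \<forall>a \<in> carrier G. \<exists>b \<in> carrier G.
    t \<otimes>\<^bsub>W\<^esub> single_W y a \<otimes>\<^bsub>W\<^esub> single_W \<one>\<^bsub>H\<^esub> b \<in> T)" for y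
  have T': "t \<in> carrier W" if "t \<in> T" for t
    using that T base_W_carrier by blast
  have refl: "P (c \<otimes>\<^bsub>H\<^esub> inv\<^bsub>H\<^esub> y)" if c: "c \<in> carrier H" "movable T c" and y: "y \<in> carrier H" "P y" for c y
  proof (cases "c \<otimes>\<^bsub>H\<^esub> inv\<^bsub>H\<^esub> y = y")
    case False
    let ?z = "c \<otimes>\<^bsub>H\<^esub> inv\<^bsub>H\<^esub> y"
    have z: "?z \<in> carrier H" "c \<otimes>\<^bsub>H\<^esub> inv\<^bsub>H\<^esub> ?z = y"
      using c y by (simp_all add: H.inv_mult_group H.m_comm H.m_assoc [symmetric])
    show ?thesis
      unfolding P_def
    proof (intro ballI)
      fix t a assume t: "t \<in> T" and a: "a \<in> carrier G"
      obtain b where b: "b \<in> carrier G" "t \<otimes>\<^bsub>W\<^esub> single_W ?z a \<otimes>\<^bsub>W\<^esub> single_W y b \<in> T"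
        using c(2) z t a False unfolding movable_def by metis
      \<comment> \<open>The reflection has left an auxiliary \<open>b\<close> at \<open>y\<close>.
        Applying \<open>P y\<close> to its inverse erases it at the cost of \<open>b'\<close> at the
        identity.\<close>
      obtain b' where b': "b' \<in> carrier G" "t \<otimes>\<^bsub>W\<^esub> single_W ?z a \<otimes>\<^bsub>W\<^esub> single_W y b \<otimes>\<^bsub>W\<^esub>
          single_W y (inv\<^bsub>G\<^esub> b) \<otimes>\<^bsub>W\<^esub> single_W \<one>\<^bsub>H\<^esub> b' \<in> T"
        using y(2) b unfolding P_def by blast
      have "single_W y b \<otimes>\<^bsub>W\<^esub> single_W y (inv\<^bsub>G\<^esub> b) = \<one>\<^bsub>W\<^esub>"
        using b(1) by (simp add: single_mult single_one)
      then have "t \<otimes>\<^bsub>W\<^esub> single_W ?z a \<otimes>\<^bsub>W\<^esub> single_W y b \<otimes>\<^bsub>W\<^esub> single_W y (inv\<^bsub>G\<^esub> b) = t \<otimes>\<^bsub>W\<^esub> single_W ?z a"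
        using T' [OF t] a b(1) y(1) z(1) by (simp add: W.m_assoc)
      then show "\<exists>b \<in> carrier G. t \<otimes>\<^bsub>W\<^esub> single_W ?z a \<otimes>\<^bsub>W\<^esub> single_W \<one>\<^bsub>H\<^esub> b \<in> T"
        using b' by auto
    qed
  qed (use y in simp)
  have P_one: "P \<one>\<^bsub>H\<^esub>"
    unfolding P_def
  proof (intro ballI)
    fix t a assume "t \<in> T" "a \<in> carrier G"
    then have "t \<otimes>\<^bsub>W\<^esub> single_W \<one>\<^bsub>H\<^esub> a \<otimes>\<^bsub>W\<^esub> single_W \<one>\<^bsub>H\<^esub> (inv\<^bsub>G\<^esub> a) \<in> T"
      using T' by (simp add: W.m_assoc single_mult single_one)
    then show "\<exists>b \<in> carrier G. t \<otimes>\<^bsub>W\<^esub> single_W \<one>\<^bsub>H\<^esub> a \<otimes>\<^bsub>W\<^esub> single_W \<one>\<^bsub>H\<^esub> b \<in> T"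
      using \<open>a \<in> carrier G\<close> by blast
  qed
  have P_inv: "P (inv\<^bsub>H\<^esub> y)" if "y \<in> carrier H" "P y" for y
    using refl [OF _ one that] that by simp
  \<comment> \<open>Here \<open>s - (-y) = s + y\<close>; the inverse translation below comes from
    \<open>-(s - y) = -s + y\<close>.\<close>
  have P_mult: "P (s \<otimes>\<^bsub>H\<^esub> y)" if "s \<in> S" "y \<in> carrier H" "P y" for s y
    using refl [of s "inv\<^bsub>H\<^esub> y"] mov P_inv that S_carrier by auto
  have P_inv_mult: "P (inv\<^bsub>H\<^esub> s \<otimes>\<^bsub>H\<^esub> y)" if "s \<in> S" "y \<in> carrier H" "P y" for s y
  proof -
    have "s \<in> carrier H"
      using that(1) S_carrier by blast
    then show ?thesis
      using P_inv [OF _ refl [OF _ mov that(2,3)]] that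
      by (simp add: H.inv_mult_group H.m_comm)
  qed
  \<comment> \<open>The free summand \<open>y\<close> makes the induction over
    \<open>generate\<close> compositional: \<open>h2\<close> translates \<open>y\<close> first and
    \<open>h1\<close> translates the result.\<close>
  have "P (x \<otimes>\<^bsub>H\<^esub> y)" if "y \<in> carrier H" "P y" for y
  proof -
    have "x \<in> generate H S"
      using x generate_S by simp
    then show ?thesis
      using that
    proof (induction arbitrary: y)
      case (eng h1 h2)
      moreover have "h1 \<in> carrier H" "h2 \<in> carrier H"
        using eng.hyps generate_S by auto
      ultimately show ?case
        by (simp add: H.m_assoc)
    qed (use P_mult P_inv_mult in auto)
  qed
  from this [OF _ P_one] have "P x"
    using x by simp
  then show ?thesis
    using t a unfolding P_def by blast
qed

text \<open>The function is built up one value at a time. A correction at the identity keeps the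
  partial product in \<open>T\<close>, and the inverse of the final correction is the value left
  over.\<close>

lemma base_eq_mult_single:
  assumes T: "T \<subseteq> base_W" and one: "movable T \<one>\<^bsub>H\<^esub>" and mov: "\<And>s. s \<in> S \<Longrightarrow> movable T s"
    and oneT: "\<one>\<^bsub>W\<^esub> \<in> T" and h: "h \<in> base_W"
  obtains t b where "t \<in> T" "b \<in> carrier G" "h = t \<otimes>\<^bsub>W\<^esub> single_W \<one>\<^bsub>H\<^esub> b"
proof -
  have "\<exists>b \<in> carrier G. h \<otimes>\<^bsub>W\<^esub> single_W \<one>\<^bsub>H\<^esub> b \<in> T"
    using h
  proof (induction rule: base_W_induct)
    case one
    then show ?case
      using oneT by (intro bexI [of _ "\<one>\<^bsub>G\<^esub>"]) (simp_all add: single_one)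
  next
    case (single g x a)
    then obtain b where b: "b \<in> carrier G" "g \<otimes>\<^bsub>W\<^esub> single_W \<one>\<^bsub>H\<^esub> b \<in> T"
      by blast
    have g: "g \<in> carrier W"
      using single.hyps(1) by (rule base_W_carrier)
    show ?case
    proof (cases "x = \<one>\<^bsub>H\<^esub>")
      case True
      \<comment> \<open>A new value at the identity itself needs no reflection; it is absorbed into
        the correction.\<close>
      have "a \<otimes>\<^bsub>G\<^esub> (inv\<^bsub>G\<^esub> a \<otimes>\<^bsub>G\<^esub> b) = b"
        using single.hyps(3) b(1) by (simp flip: G.m_assoc)
      then have "g \<otimes>\<^bsub>W\<^esub> single_W x a \<otimes>\<^bsub>W\<^esub> single_W \<one>\<^bsub>H\<^esub> (inv\<^bsub>G\<^esub> a \<otimes>\<^bsub>G\<^esub> b) = g \<otimes>\<^bsub>W\<^esub> single_W \<one>\<^bsub>H\<^esub> b"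
        using True g single.hyps(3) b(1) by (simp add: W.m_assoc single_mult)
      then show ?thesis
        using b single.hyps(3) by (intro bexI [of _ "inv\<^bsub>G\<^esub> a \<otimes>\<^bsub>G\<^esub> b"]) simp_all
    next
      case False
      obtain b' where b': "b' \<in> carrier G"
        "g \<otimes>\<^bsub>W\<^esub> single_W \<one>\<^bsub>H\<^esub> b \<otimes>\<^bsub>W\<^esub> single_W x a \<otimes>\<^bsub>W\<^esub> single_W \<one>\<^bsub>H\<^esub> b' \<in> T"
        using push_to_one [OF T one mov b(2) single.hyps(2,3)] by blast
      have "single_W \<one>\<^bsub>H\<^esub> b \<otimes>\<^bsub>W\<^esub> single_W x a = single_W x a \<otimes>\<^bsub>W\<^esub> single_W \<one>\<^bsub>H\<^esub> b"
        using False b(1) single.hyps(3) by (metis single_commute)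
      then have "g \<otimes>\<^bsub>W\<^esub> single_W \<one>\<^bsub>H\<^esub> b \<otimes>\<^bsub>W\<^esub> single_W x a = g \<otimes>\<^bsub>W\<^esub> single_W x a \<otimes>\<^bsub>W\<^esub> single_W \<one>\<^bsub>H\<^esub> b"
        using g b(1) single.hyps(2,3) by (simp add: W.m_assoc)
      then have "g \<otimes>\<^bsub>W\<^esub> single_W \<one>\<^bsub>H\<^esub> b \<otimes>\<^bsub>W\<^esub> single_W x a \<otimes>\<^bsub>W\<^esub> single_W \<one>\<^bsub>H\<^esub> b' =
          g \<otimes>\<^bsub>W\<^esub> single_W x a \<otimes>\<^bsub>W\<^esub> single_W \<one>\<^bsub>H\<^esub> (b \<otimes>\<^bsub>G\<^esub> b')"
        using g b(1) b'(1) single.hyps(2,3) by (simp add: W.m_assoc single_mult)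
      then show ?thesis
        using b(1) b' by (intro bexI [of _ "b \<otimes>\<^bsub>G\<^esub> b'"]) simp_all
    qed
  qed
  then obtain b where b: "b \<in> carrier G" "h \<otimes>\<^bsub>W\<^esub> single_W \<one>\<^bsub>H\<^esub> b \<in> T"
    by blast
  show thesis
  proof
    show "h = h \<otimes>\<^bsub>W\<^esub> single_W \<one>\<^bsub>H\<^esub> b \<otimes>\<^bsub>W\<^esub> single_W \<one>\<^bsub>H\<^esub> (inv\<^bsub>G\<^esub> b)"
      using b(1) base_W_carrier [OF h] by (simp add: W.m_assoc single_mult single_one)
  qed (use b in auto)
qed

section \<open>One factor for each reflection\<close>

text \<open>\<open>extendable\<close> comes last so that it is adjacent to the value left over at
  the identity, whose first palindrome it has to carry.\<close>

definition factors where
  "factors ss = foldr (\<lambda>s T. symmetric_about s <#>\<^bsub>W\<^esub> T) ss extendable"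

lemma factors_Nil: "factors [] = extendable"
  by (simp add: factors_def)

lemma factors_Cons: "factors (s # ss) = symmetric_about s <#>\<^bsub>W\<^esub> factors ss"
  by (simp add: factors_def)

lemma symmetric_about_subset: "symmetric_about c \<subseteq> base_W"
  by (auto simp: symmetric_about_def)

lemma factors_subset: "factors ss \<subseteq> base_W"
proof (induction ss)
  case Nil
  then show ?case
    by (auto simp: factors_Nil extendable_def)
next
  case (Cons s ss)
  then show ?case
    using symmetric_about_subset base_W_mult unfolding factors_Cons set_mult_def by blast
qed

lemma one_factors: "set ss \<subseteq> S \<Longrightarrow> \<one>\<^bsub>W\<^esub> \<in> factors ss"
proof (induction ss)
  case Nil
  then show ?case
    by (simp add: factors_Nil one_extendable)
next
  case (Cons s ss)
  then have "\<one>\<^bsub>W\<^esub> \<in> symmetric_about s" "\<one>\<^bsub>W\<^esub> \<in> factors ss"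
    using one_symmetric by simp_all
  moreover have "\<one>\<^bsub>W\<^esub> = \<one>\<^bsub>W\<^esub> \<otimes>\<^bsub>W\<^esub> \<one>\<^bsub>W\<^esub>"
    by simp
  ultimately show ?case
    unfolding factors_Cons set_mult_def by blast
qed

text \<open>Only the factor belonging to \<open>c\<close> is altered. Factors to its left are
  untouched, and values are conjugated past those to its right.\<close>

lemma movable_factors:
  assumes "set ss \<subseteq> S" "c = \<one>\<^bsub>H\<^esub> \<or> c \<in> set ss"
  shows "movable (factors ss) c"
  using assms
proof (induction ss)
  case Nil
  then show ?case
    using movable_extendable by (simp add: factors_Nil)
next
  case (Cons s ss)
  have c: "c \<in> carrier H"
    using Cons.prems S_carrier by auto
  show ?case
  proof (cases "c = s")
    case True
    then show ?thesis
      unfolding factors_Cons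
      using movable_mult_right [OF movable_symmetric symmetric_about_subset factors_subset] c by blast
  next
    case False
    then have "movable (factors ss) c"
      using Cons by auto
    then show ?thesis
      unfolding factors_Cons
      using movable_mult_left factors_subset symmetric_about_subset c by blast
  qed
qed

section \<open>Counting palindromes up to displacement\<close>

text \<open>
  The displacements \<open>v\<close> and \<open>v'\<close> make this notion multiplicative: adjacent displacements cancel, so
  only a single element of \<open>H\<close> is left over at the end of a product.
\<close>
definition translated_products where
  "translated_products k = {g \<in> carrier W. \<forall>v \<in> carrier H. \<exists>v' \<in> carrier H.
    top_W v \<otimes>\<^bsub>W\<^esub> g \<otimes>\<^bsub>W\<^esub> top_W v' \<in> palindrome_products W gens k}"

lemma translated_products_mono: "m \<le> n \<Longrightarrow> translated_products m \<subseteq> translated_products n"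
  using palindrome_products_mono [of m n W gens] unfolding translated_products_def by blast

lemma translated_products_one: "\<one>\<^bsub>W\<^esub> \<in> translated_products 0"
proof -
  have "top_W v \<otimes>\<^bsub>W\<^esub> \<one>\<^bsub>W\<^esub> \<otimes>\<^bsub>W\<^esub> top_W (inv\<^bsub>H\<^esub> v) = \<one>\<^bsub>W\<^esub>" if "v \<in> carrier H" for v
    using that by (simp add: top_mult top_one)
  then show ?thesis
    unfolding translated_products_def
    using W.palindrome_products_one by (auto intro!: bexI [of _ "inv\<^bsub>H\<^esub> _"])
qed

lemma translated_products_mult:
  assumes g: "g \<in> translated_products m" and h: "h \<in> translated_products n"
  shows "g \<otimes>\<^bsub>W\<^esub> h \<in> translated_products (m + n)"
proof -
  have gh: "g \<in> carrier W" "h \<in> carrier W"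
    using g h by (auto simp: translated_products_def)
  have "\<exists>v' \<in> carrier H. top_W v \<otimes>\<^bsub>W\<^esub> (g \<otimes>\<^bsub>W\<^esub> h) \<otimes>\<^bsub>W\<^esub> top_W v' \<in> palindrome_products W gens (m + n)"
    if v: "v \<in> carrier H" for v
  proof -
    obtain u where u: "u \<in> carrier H" "top_W v \<otimes>\<^bsub>W\<^esub> g \<otimes>\<^bsub>W\<^esub> top_W u \<in> palindrome_products W gens m"
      using g v unfolding translated_products_def by blast
    \<comment> \<open>Starting the second product with the displacement inverse to \<open>u\<close>
      makes the two inner displacements cancel.\<close>
    obtain u' where u': "u' \<in> carrier H"
      "top_W (inv\<^bsub>H\<^esub> u) \<otimes>\<^bsub>W\<^esub> h \<otimes>\<^bsub>W\<^esub> top_W u' \<in> palindrome_products W gens n"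
      using h H.inv_closed [OF u(1)] unfolding translated_products_def by blast
    have "top_W u \<otimes>\<^bsub>W\<^esub> (top_W (inv\<^bsub>H\<^esub> u) \<otimes>\<^bsub>W\<^esub> (h \<otimes>\<^bsub>W\<^esub> top_W u')) =
        top_W u \<otimes>\<^bsub>W\<^esub> top_W (inv\<^bsub>H\<^esub> u) \<otimes>\<^bsub>W\<^esub> (h \<otimes>\<^bsub>W\<^esub> top_W u')"
      using u(1) u'(1) gh by (simp add: W.m_assoc)
    also have "\<dots> = h \<otimes>\<^bsub>W\<^esub> top_W u'"
      using u(1) u'(1) gh by (simp add: top_mult top_one)
    finally have "(top_W v \<otimes>\<^bsub>W\<^esub> g \<otimes>\<^bsub>W\<^esub> top_W u) \<otimes>\<^bsub>W\<^esub> (top_W (inv\<^bsub>H\<^esub> u) \<otimes>\<^bsub>W\<^esub> h \<otimes>\<^bsub>W\<^esub> top_W u') =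
        top_W v \<otimes>\<^bsub>W\<^esub> (g \<otimes>\<^bsub>W\<^esub> h) \<otimes>\<^bsub>W\<^esub> top_W u'"
      using u(1) u'(1) gh v by (simp add: W.m_assoc)
    then show ?thesis
      using W.palindrome_products_mult [OF gens_carrier u(2) u'(2)] u'(1) by auto
  qed
  then show ?thesis
    using gh by (simp add: translated_products_def)
qed

text \<open>\<open>top_W v\<close> is its own reversal because \<open>H\<close> is abelian, so it
  may enclose the palindrome \<open>g \<otimes> top_W c\<close>. The displacement to be chosen on
  the right is then \<open>c + v\<close>.\<close>

lemma symmetric_about_translated_products:
  assumes g: "g \<in> symmetric_about c" and c: "c \<in> carrier H"
  shows "g \<in> translated_products 1"
proof -
  have gW: "g \<in> carrier W"
    using g base_W_carrier by (simp add: symmetric_about_def)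
  have "top_W v \<otimes>\<^bsub>W\<^esub> g \<otimes>\<^bsub>W\<^esub> top_W (c \<otimes>\<^bsub>H\<^esub> v) \<in> palindrome_products W gens 1"
    if v: "v \<in> carrier H" for v
  proof -
    have "top_W v \<otimes>\<^bsub>W\<^esub> (g \<otimes>\<^bsub>W\<^esub> top_W c) \<otimes>\<^bsub>W\<^esub> top_W v \<in> palindromic W gens"
      using g by (intro W.palindromic_sandwich [OF gens_carrier] top_reversal v)
        (simp add: symmetric_about_def)
    also have "top_W v \<otimes>\<^bsub>W\<^esub> (g \<otimes>\<^bsub>W\<^esub> top_W c) \<otimes>\<^bsub>W\<^esub> top_W v =
        top_W v \<otimes>\<^bsub>W\<^esub> g \<otimes>\<^bsub>W\<^esub> top_W (c \<otimes>\<^bsub>H\<^esub> v)"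
      using v c gW by (simp add: W.m_assoc top_mult)
    finally show ?thesis
      by (rule W.palindrome_products_palindromic [OF gens_carrier])
  qed
  then show ?thesis
    using gW c unfolding translated_products_def by blast
qed

lemma single_one_translated_products:
  "set ps \<subseteq> palindromic G A \<Longrightarrow> single_W \<one>\<^bsub>H\<^esub> (group_prod G ps) \<in> translated_products (length ps)"
proof (induction ps)
  case Nil
  then show ?case
    by (simp add: single_one translated_products_one)
next
  case (Cons p ps)
  have "set (p # ps) \<subseteq> carrier G"
    using Cons.prems G.palindromic_carrier [OF A_carrier] by (rule subset_trans)
  then have pG: "p \<in> carrier G" "group_prod G ps \<in> carrier G"
    by (simp_all add: G.group_prod_closed)
  have "single_W \<one>\<^bsub>H\<^esub> p \<in> translated_products 1"
    using Cons.prems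
    by (intro symmetric_about_translated_products [of _ "\<one>\<^bsub>H\<^esub>"] single_one_symmetric) simp_all
  moreover have "single_W \<one>\<^bsub>H\<^esub> (group_prod G ps) \<in> translated_products (length ps)"
    using Cons by simp
  ultimately have "single_W \<one>\<^bsub>H\<^esub> p \<otimes>\<^bsub>W\<^esub> single_W \<one>\<^bsub>H\<^esub> (group_prod G ps) \<in> translated_products (1 + length ps)"
    by (rule translated_products_mult)
  then show ?case
    using pG by (simp add: single_mult)
qed

text \<open>\<open>d\<close> shares one palindrome with the first entry of \<open>ps\<close>, so the
  count is \<open>length ps\<close> and not one more.\<close>

lemma extendable_translated_products:
  assumes d: "d \<in> extendable" and ps: "set ps \<subseteq> palindromic G A" "ps \<noteq> []"
  shows "d \<otimes>\<^bsub>W\<^esub> single_W \<one>\<^bsub>H\<^esub> (group_prod G ps) \<in> translated_products (length ps)"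
proof -
  obtain p qs where pq: "ps = p # qs"
    using ps(2) by (cases ps) auto
  have dW: "d \<in> carrier W"
    using d base_W_carrier by (simp add: extendable_def)
  have "set (p # qs) \<subseteq> carrier G"
    using ps(1) G.palindromic_carrier [OF A_carrier] unfolding pq by (rule subset_trans)
  then have pG: "p \<in> carrier G" "group_prod G qs \<in> carrier G"
    by (simp_all add: G.group_prod_closed)
  have "d \<otimes>\<^bsub>W\<^esub> single_W \<one>\<^bsub>H\<^esub> p \<in> translated_products 1"
  proof (rule symmetric_about_translated_products)
    have "p \<in> palindromic G A"
      using ps(1) unfolding pq by simp
    then show "d \<otimes>\<^bsub>W\<^esub> single_W \<one>\<^bsub>H\<^esub> p \<in> symmetric_about \<one>\<^bsub>H\<^esub>"
      using d unfolding extendable_def by blast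
  qed simp
  moreover have "single_W \<one>\<^bsub>H\<^esub> (group_prod G qs) \<in> translated_products (length qs)"
    using ps(1) unfolding pq by (intro single_one_translated_products) simp
  ultimately have "d \<otimes>\<^bsub>W\<^esub> single_W \<one>\<^bsub>H\<^esub> p \<otimes>\<^bsub>W\<^esub> single_W \<one>\<^bsub>H\<^esub> (group_prod G qs)
      \<in> translated_products (1 + length qs)"
    by (rule translated_products_mult)
  then show ?thesis
    unfolding pq using dW pG by (simp add: single_mult W.m_assoc)
qed

lemma factors_translated_products:
  assumes "set ss \<subseteq> S" "t \<in> factors ss" and ps: "set ps \<subseteq> palindromic G A" "ps \<noteq> []"
  shows "t \<otimes>\<^bsub>W\<^esub> single_W \<one>\<^bsub>H\<^esub> (group_prod G ps) \<in> translated_products (length ss + length ps)"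
  using assms(1,2)
proof (induction ss arbitrary: t)
  case Nil
  then show ?case
    using extendable_translated_products [OF _ ps] by (simp add: factors_Nil)
next
  case (Cons s ss)
  obtain g t' where t: "g \<in> symmetric_about s" "t' \<in> factors ss" "t = g \<otimes>\<^bsub>W\<^esub> t'"
    using Cons.prems(2) unfolding factors_Cons set_mult_def by blast
  have "s \<in> carrier H"
    using Cons.prems(1) S_carrier by auto
  then have "g \<otimes>\<^bsub>W\<^esub> (t' \<otimes>\<^bsub>W\<^esub> single_W \<one>\<^bsub>H\<^esub> (group_prod G ps))
      \<in> translated_products (1 + (length ss + length ps))"
    using Cons.prems(1) t(2)
    by (intro translated_products_mult [OF symmetric_about_translated_products [OF t(1)]] Cons.IH) simp_all
  moreover have "g \<in> carrier W" "t' \<in> carrier W"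
    using t symmetric_about_subset factors_subset base_W_carrier by blast+
  moreover have "group_prod G ps \<in> carrier G"
    using subset_trans [OF ps(1) G.palindromic_carrier [OF A_carrier]] by (rule G.group_prod_closed)
  ultimately show ?case
    using t(3) by (simp add: W.m_assoc)
qed

section \<open>Assembling the bound\<close>

text \<open>In the abelian group \<open>H\<close> every element is a product of one power of each
  generator, and a power of a letter or of its inverse is a palindrome.\<close>

lemma top_palindrome_products:
  assumes "v \<in> carrier H"
  shows "top_W v \<in> palindrome_products W gens (card S)"
proof -
  interpret top: group_hom H W top_W
    by (rule group_hom_top)
  have "top_W v \<in> palindrome_products W gens (card R)" if "finite R" "R \<subseteq> S" "v \<in> generate H R" for R v
    using that
  proof (induction R arbitrary: v rule: finite_induct)
    case empty
    then show ?case
      using H.generate_empty W.palindrome_products_one by (simp add: top_one)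
  next
    case (insert s R)
    then have sR: "insert s R \<subseteq> carrier H"
      using S_carrier by blast
    obtain k :: int and u where u: "u \<in> generate H R" "v = s [^]\<^bsub>H\<^esub> k \<otimes>\<^bsub>H\<^esub> u"
      using H.generate_insert [OF sR insert.prems(2)] by blast
    have "s [^]\<^bsub>H\<^esub> k \<in> palindromic H S"
      using insert.prems by (intro H.palindromic_int_pow S_carrier) simp
    then have "top_W (s [^]\<^bsub>H\<^esub> k) \<in> palindrome_products W gens 1"
      by (intro W.palindrome_products_palindromic [OF gens_carrier]
          top.palindromic_image [OF S_carrier top_image])
    moreover have "top_W u \<in> palindrome_products W gens (card R)"
      using insert.IH insert.prems u(1) by simp
    ultimately have "top_W (s [^]\<^bsub>H\<^esub> k) \<otimes>\<^bsub>W\<^esub> top_W u \<in> palindrome_products W gens (1 + card R)"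
      by (rule W.palindrome_products_mult [OF gens_carrier])
    moreover have "u \<in> carrier H"
      using H.generate_in_carrier [OF _ u(1)] sR by blast
    moreover have "s [^]\<^bsub>H\<^esub> k \<in> carrier H"
      using sR by (intro H.int_pow_closed) blast
    moreover have "1 + card R = card (insert s R)"
      using insert.hyps by simp
    ultimately show ?case
      unfolding u(2) by (simp only: top_mult)
  qed
  then show ?thesis
    using finite_S generate_S assms by simp
qed

lemma carrier_subset_palindrome_products:
  assumes n: "carrier G \<subseteq> palindrome_products G A n"
  shows "carrier W \<subseteq> palindrome_products W gens (2 * card S + n)"
proof
  fix w assume "w \<in> carrier W"
  then obtain h v where w: "h \<in> base_W" "v \<in> carrier H" "w = h \<otimes>\<^bsub>W\<^esub> top_W v"
    by (rule base_top_decomposition)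
  show "w \<in> palindrome_products W gens (2 * card S + n)"
  proof (cases "n = 0")
    case True
    then have triv: "a = \<one>\<^bsub>G\<^esub>" if "a \<in> carrier G" for a
      using n that by (auto simp: palindrome_products_def)
    have "h = \<one>\<^bsub>W\<^esub>"
      using w(1)
    proof (induction rule: base_W_induct)
      case (single g x a)
      then show ?case
        using triv [of a] by (simp add: single_one)
    qed simp
    then have "w = top_W v"
      using w(2,3) by simp
    then show ?thesis
      using top_palindrome_products [OF w(2)] palindrome_products_mono [of "card S" "2 * card S + n" W gens]
      by auto
  next
    case False
    obtain ss where ss: "set ss = S" "distinct ss"
      using finite_distinct_list [OF finite_S] by blast
    have len: "length ss = card S"
      using distinct_card [OF ss(2)] ss(1) by simp
    obtain t b where tb: "t \<in> factors ss" "b \<in> carrier G" "h = t \<otimes>\<^bsub>W\<^esub> single_W \<one>\<^bsub>H\<^esub> b"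
    proof (rule base_eq_mult_single [OF factors_subset _ _ one_factors w(1)])
      show "movable (factors ss) \<one>\<^bsub>H\<^esub>" "\<And>s. s \<in> S \<Longrightarrow> movable (factors ss) s" "set ss \<subseteq> S"
        using movable_factors ss(1) by auto
    qed
    obtain qs where qs: "length qs \<le> n" "set qs \<subseteq> palindromic G A" "b = group_prod G qs"
      using tb(2) n unfolding palindrome_products_def by blast
    \<comment> \<open>\<open>extendable\<close> needs a first palindrome to absorb. An empty list is
      replaced by the trivial palindrome, which keeps the length within \<open>n\<close> since
      \<open>n\<close> is positive here.\<close>
    define ps where "ps = (if qs = [] then [\<one>\<^bsub>G\<^esub>] else qs)"
    have ps: "length ps \<le> n" "set ps \<subseteq> palindromic G A" "b = group_prod G ps" "ps \<noteq> []"
      using qs False G.palindromic_one by (auto simp: ps_def)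
    have "h \<in> translated_products (card S + length ps)"
      using factors_translated_products [OF _ tb(1) ps(2,4)] ss(1) len tb(3) ps(3) by simp
    then have "h \<in> translated_products (card S + n)"
      using translated_products_mono [of "card S + length ps" "card S + n"] ps(1) by auto
    then obtain v' where v': "v' \<in> carrier H"
      "top_W \<one>\<^bsub>H\<^esub> \<otimes>\<^bsub>W\<^esub> h \<otimes>\<^bsub>W\<^esub> top_W v' \<in> palindrome_products W gens (card S + n)"
      unfolding translated_products_def by blast
    \<comment> \<open>The palindromes for \<open>h\<close> end at the uncontrolled displacement
      \<open>v'\<close>; \<open>?u\<close> corrects it to \<open>v\<close> with at most
      \<open>card S\<close> further palindromes.\<close>
    let ?u = "inv\<^bsub>H\<^esub> v' \<otimes>\<^bsub>H\<^esub> v"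
    have "top_W \<one>\<^bsub>H\<^esub> \<otimes>\<^bsub>W\<^esub> h \<otimes>\<^bsub>W\<^esub> top_W v' \<otimes>\<^bsub>W\<^esub> top_W ?u \<in> palindrome_products W gens (card S + n + card S)"
      using v'(1) w(2)
      by (intro W.palindrome_products_mult [OF gens_carrier v'(2)] top_palindrome_products) simp_all
    moreover have "v' \<otimes>\<^bsub>H\<^esub> ?u = v"
      using v'(1) w(2) by (simp flip: H.m_assoc)
    then have "top_W \<one>\<^bsub>H\<^esub> \<otimes>\<^bsub>W\<^esub> h \<otimes>\<^bsub>W\<^esub> top_W v' \<otimes>\<^bsub>W\<^esub> top_W ?u = w"
      using v'(1) w base_W_carrier [OF w(1)] by (simp add: top_one W.m_assoc top_mult)
    moreover have "card S + n + card S = 2 * card S + n"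
      by simp
    ultimately show ?thesis
      by (simp only:)
  qed
qed

end

text \<open>\<open>S\<close> is counted twice: once for the reflections about its elements and once
  for the final element of \<open>H\<close>. If the width of \<open>G\<close> is infinite, the bound
  is trivial.\<close>

theorem palindromic_width_wreath_le:
  fixes G :: "('a, 'b) monoid_scheme" and H :: "('h, 'c) monoid_scheme"
  assumes "group G" "A \<subseteq> carrier G" "generate G A = carrier G"
    and "comm_group H" "S \<subseteq> carrier H" "finite S" "generate H S = carrier H"
  shows "palindromic_width (wreath G H) (wreath_base G H ` A \<union> wreath_top G H ` S)
    \<le> enat (2 * card S) + palindromic_width G A"
proof (cases "palindromic_width G A")
  case (enat n)
  interpret generated_wreath_product G H A S
    using assms by (intro generated_wreath_product.intro wreath_product.intro
        generated_wreath_product_axioms.intro)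
  have "carrier G \<subseteq> palindrome_products G A n"
    using enat by (simp flip: palindromic_width_le_iff)
  then show ?thesis
    using carrier_subset_palindrome_products by (simp add: enat gens_def flip: palindromic_width_le_iff)
qed simp

section \<open>The integer lattice and its standard basis\<close>

lemma standard_basis_subset: "standard_basis r \<subseteq> carrier (int_lattice r)"
  unfolding standard_basis_def by (intro image_subsetI) (simp add: restrict_PiE_iff)

lemma generate_standard_basis:
  "generate (int_lattice r) (standard_basis r) = carrier (int_lattice r)"
proof -
  interpret L: group "int_lattice r"
    by simp
  have basis_carrier: "standard_basis r \<subseteq> carrier (int_lattice r)"
    by (rule standard_basis_subset)
  interpret K: subgroup "generate (int_lattice r) (standard_basis r)" "int_lattice r"
    by (rule L.generate_is_subgroup [OF basis_carrier])
  \<comment> \<open>\<open>e i z\<close> is \<open>z\<close> times the \<open>i\<close>-th basis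
    vector.\<close>
  define e where "e i z = (\<lambda>j \<in> {..<r}. if j = i then z else 0)" for i and z :: int
  have e_add: "e i x \<otimes>\<^bsub>int_lattice r\<^esub> e i y = e i (x + y)" for i x y
    by (auto simp: e_def intro!: restrict_ext)
  have e_mem: "e i z \<in> generate (int_lattice r) (standard_basis r)" if "i < r" for i z
  proof -
    have "e i 1 \<in> standard_basis r"
      using that by (auto simp: standard_basis_def e_def)
    then have e1: "e i 1 \<in> generate (int_lattice r) (standard_basis r)"
      by (rule generate.incl)
    have nat: "e i (int n) \<in> generate (int_lattice r) (standard_basis r)" for n
    proof (induction n)
      case 0
      have "e i (int 0) = \<one>\<^bsub>int_lattice r\<^esub>"
        by (auto simp: e_def)
      then show ?case
        using K.one_closed by (simp only:)
    next
      case (Suc n)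
      have "e i (int (Suc n)) = e i 1 \<otimes>\<^bsub>int_lattice r\<^esub> e i (int n)"
        by (simp only: e_add of_nat_Suc)
      then show ?case
        using K.m_closed [OF e1 Suc] by (simp only:)
    qed
    have "e i (- int n) = inv\<^bsub>int_lattice r\<^esub> e i (int n)" for n
      by (subst inv_product_group) (auto simp: e_def)
    then show ?thesis
      using nat K.m_inv_closed [OF nat] by (cases z rule: int_cases2) (simp_all only:)
  qed
  \<comment> \<open>The induction runs over the number \<open>k\<close> of leading coordinates that
    may be nonzero and splits off the last of them.\<close>
  have "v \<in> generate (int_lattice r) (standard_basis r)"
    if "v \<in> carrier (int_lattice r)" "k \<le> r" "\<And>j. k \<le> j \<Longrightarrow> j < r \<Longrightarrow> v j = 0" for v k
    using that
  proof (induction k arbitrary: v)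
    case 0
    then have "v = \<one>\<^bsub>int_lattice r\<^esub>"
      by (auto simp: PiE_iff extensional_def)
    then show ?case
      using K.one_closed by (simp only:)
  next
    case (Suc k)
    define u where "u = (\<lambda>j \<in> {..<r}. if j = k then 0 else v j)"
    have "u \<in> generate (int_lattice r) (standard_basis r)"
      using Suc.prems by (intro Suc.IH) (auto simp: u_def)
    then have "u \<otimes>\<^bsub>int_lattice r\<^esub> e k (v k) \<in> generate (int_lattice r) (standard_basis r)"
      using Suc.prems(2) by (intro K.m_closed e_mem) simp_all
    moreover have "v = u \<otimes>\<^bsub>int_lattice r\<^esub> e k (v k)"
      using Suc.prems(1) by (auto simp: u_def e_def PiE_iff extensional_def)
    ultimately show ?case
      by (simp only:)
  qed
  from this [OF _ order_refl] have "carrier (int_lattice r) \<subseteq> generate (int_lattice r) (standard_basis r)"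
    by (rule subsetI) simp_all
  with L.generate_incl [OF basis_carrier] show ?thesis
    by (rule equalityI)
qed

lemma comm_group_int_lattice: "comm_group (int_lattice r)"
  by (rule group.group_comm_groupI) (simp_all add: add.commute)

theorem theorem1p1:
  fixes G :: "('a, 'b) monoid_scheme" and A :: "'a set"
  assumes "group G" and "finite A" and "A \<subseteq> carrier G" and "generate G A = carrier G"
  shows "(\<forall>r::nat. r \<ge> 1 \<longrightarrow>
      palindromic_width (wreath G (int_lattice r))
        (wreath_base G (int_lattice r) ` A \<union> wreath_top G (int_lattice r) ` standard_basis r)
      \<le> enat (3 * r) + palindromic_width G A) \<and>
    (\<forall>t::int. generate integer_group {t} = carrier integer_group \<longrightarrow>
      palindromic_width (wreath G integer_group)
        (wreath_base G integer_group ` A \<union> {wreath_top G integer_group t})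
      \<le> 2 + palindromic_width G A)"
proof (intro conjI allI impI)
  fix r :: nat
  have "card (standard_basis r) \<le> card {..<r}"
    unfolding standard_basis_def by (rule card_image_le) simp
  \<comment> \<open>The general bound already gives \<open>2 * r\<close>, which is at most the
    required \<open>3 * r\<close>.\<close>
  then have le: "2 * card (standard_basis r) \<le> 3 * r"
    by simp
  have "palindromic_width (wreath G (int_lattice r))
      (wreath_base G (int_lattice r) ` A \<union> wreath_top G (int_lattice r) ` standard_basis r)
    \<le> enat (2 * card (standard_basis r)) + palindromic_width G A"
  proof (rule palindromic_width_wreath_le)
    show "finite (standard_basis r)"
      by (simp add: standard_basis_def)
  qed (rule assms comm_group_int_lattice generate_standard_basis standard_basis_subset)+
  also have "\<dots> \<le> enat (3 * r) + palindromic_width G A"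
    using le by (intro add_right_mono) simp
  finally show "palindromic_width (wreath G (int_lattice r))
      (wreath_base G (int_lattice r) ` A \<union> wreath_top G (int_lattice r) ` standard_basis r)
    \<le> enat (3 * r) + palindromic_width G A" .
next
  fix t :: int
  assume "generate integer_group {t} = carrier integer_group"
  \<comment> \<open>With a single generator \<open>t\<close> the general bound
    \<open>2 * card {t}\<close> equals 2.\<close>
  then have "palindromic_width (wreath G integer_group)
      (wreath_base G integer_group ` A \<union> wreath_top G integer_group ` {t})
    \<le> enat (2 * card {t}) + palindromic_width G A"
    by (intro palindromic_width_wreath_le assms abelian_integer_group) simp_all
  then show "palindromic_width (wreath G integer_group)
      (wreath_base G integer_group ` A \<union> {wreath_top G integer_group t})
    \<le> 2 + palindromic_width G A"
    by (simp add: numeral_eq_enat)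
qed

end
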